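(* Let $\Omega\subset B(\mathcal H)^d$ and let $f:\Omega\to B(\mathcal H)^r$ be a strong NC function. If $Df(x):B(\mathcal H)^d\to B(\mathcal H)^r$ is injective for every $x\in\Omega$, then $Df(x)$ is bounded below for every $x\in\Omega$.
   Context: Throughout, $\mathcal H$ is an infinite-dimensional separable complex Hilbert space, $B(\mathcal H)$ the bounded operators with the operator norm, and $\mathcal H^{(l)}$ ($l\in\mathbb N\cup\{\infty\}$) the direct sum of $l$ copies of $\mathcal H$. $B(\mathcal H)^d$ has the norm $\|x\|=\max_i\|x^i\|$. Operations on tuples are componentwise: for bounded invertible linear $s:\mathcal H\to\mathcal H^{(l)}$ and $z\in B(\mathcal H^{(l)})^d$, $s^{-1}zs=(s^{-1}z^1s,\dots,s^{-1}z^ds)$; for a finite or countable uniformly bounded sequence $x_1,x_2,\dots$ in $B(\mathcal H)^d$ of length $l$, $\bigoplus_n x_n\in B(\mathcal H^{(l)})^d$ has $i$-th entry $\bigoplus_n x_n^i$; block matrices of tuples are defined entrywise per coordinate. A set is unitarily invariant if $u^*xu$ lies in it for each of its elements $x$ and each unitary $u\in B(\mathcal H)$. The strong operator topology (SOT) on $B(\mathcal H)^d$ is the product of the SOT on each coordinate. NC domain: $\Omega\subset B(\mathcal H)^d$ is an NC domain if there are subsets $\Omega_1,\Omega_2,\dots$ of $\Omega$ with (1) $\Omega_k\subset\mathrm{int}\,\Omega_{k+1}$ (norm interior) and $\Omega=\bigcup_k\Omega_k$; (2) each $\Omega_k$ norm-bounded and unitarily invariant; (3) for every sequence $x_1,x_2,\dots$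 in $\Omega_k$ of length $l\in\mathbb N\cup\{\infty\}$ there is a unitary $u:\mathcal H\to\mathcal H^{(l)}$ with $u^{-1}(\bigoplus_n x_n)u\in\Omega_k$. NC function: $f:\Omega\to B(\mathcal H)^r$ on an NC domain is NC if whenever $x,y\in\Omega$ and $s:\mathcal H\to\mathcal H^{(2)}$ is bounded, linear, invertible with $s^{-1}\begin{bmatrix}x&0\\0&y\end{bmatrix}s\in\Omega$, then $f\Big(s^{-1}\begin{bmatrix}x&0\\0&y\end{bmatrix}s\Big)=s^{-1}\begin{bmatrix}f(x)&0\\0&f(y)\end{bmatrix}s$. Every NC function is Fréchet differentiable; $Df(x)$ denotes its Fréchet derivative at $x$. Strong NC domain: $\Omega$ is a strong NC domain if it has an exhausting sequence $\{\Omega_k\}$ as in the definition of NC domain such that, additionally, (i) each $\Omega_k$ is closed in the strong operator topology, and (ii) for each $k$ there is $\varepsilon_k>0$ such that $\Omega_{k+1}$ contains $\{x\in B(\mathcal H)^d:\mathrm{dist}(x,\Omega_k)<\varepsilon_k\}$. Strong NC function: $f:\Omega\to B(\mathcal H)^r$ is a strong NC function if $f$ is an NC function and there is an exhausting sequence $\{\Omega_k\}$ of $\Omega$ as in the definition of strong NC domain such that each restriction $f|_{\Omega_k}$ is continuous for the strong operator topology. An operator $T$ is bounded below if $\|Tv\|\ge C\|v\|$ for some $C>0$ and all $v$. *)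

theory Defs
  imports "HOL-Analysis.Analysis" "HOL-Library.Extended_Nat"
begin

text \<open>Model of the complex Hilbert space H: a real Hilbert space (type of class real_inner and
complete_space) together with an orthogonal complex structure J (J J = -1, J isometric).
Complex scalars act by (a + i b) v = a v + b J v.  Complex-linear bounded operators are
the real bounded operators commuting with J.\<close>

definition cbl :: "('h::real_normed_vector \<Rightarrow>\<^sub>L 'h) \<Rightarrow> ('h \<Rightarrow>\<^sub>L 'h) \<Rightarrow> bool" where
  "cbl J T \<longleftrightarrow> T o\<^sub>L J = J o\<^sub>L T"

definition BH :: "('h::real_normed_vector \<Rightarrow>\<^sub>L 'h) \<Rightarrow> (('h \<Rightarrow>\<^sub>L 'h)^'d) set" where
  "BH J = {x. \<forall>i. cbl J (x$i)}"

definition tnorm :: "('a::real_normed_vector)^'d \<Rightarrow> real" where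
  "tnorm x = Max (range (\<lambda>i. norm (x$i)))"

definition cscaleT :: "('h::real_normed_vector \<Rightarrow>\<^sub>L 'h) \<Rightarrow> complex \<Rightarrow> ('h \<Rightarrow>\<^sub>L 'h)^'d \<Rightarrow> ('h \<Rightarrow>\<^sub>L 'h)^'d" where
  "cscaleT J c x = (\<chi> i. Re c *\<^sub>R x$i + Im c *\<^sub>R (J o\<^sub>L x$i))"

definition cunitary :: "('h::real_normed_vector \<Rightarrow>\<^sub>L 'h) \<Rightarrow> ('h \<Rightarrow>\<^sub>L 'h) \<Rightarrow> ('h \<Rightarrow>\<^sub>L 'h) \<Rightarrow> bool" where
  "cunitary J u w \<longleftrightarrow> cbl J u \<and> w o\<^sub>L u = id_blinfun \<and> u o\<^sub>L w = id_blinfun \<and>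
     (\<forall>v. norm (blinfun_apply u v) = norm v)"

definition unit_inv :: "('h::real_normed_vector \<Rightarrow>\<^sub>L 'h) \<Rightarrow> (('h \<Rightarrow>\<^sub>L 'h)^'d) set \<Rightarrow> bool" where
  "unit_inv J S \<longleftrightarrow> (\<forall>x\<in>S. \<forall>u w. cunitary J u w \<longrightarrow> (\<chi> i. w o\<^sub>L x$i o\<^sub>L u) \<in> S)"

text \<open>H^(l) (l :: enat, l \<ge> 1) is modelled as the square-summable functions nat \<Rightarrow> H vanishing
outside {n. n < l}; u is a unitary from H onto H^(l).\<close>
definition unitary_to_sum :: "('h::real_normed_vector \<Rightarrow>\<^sub>L 'h) \<Rightarrow> enat \<Rightarrow> ('h \<Rightarrow> nat \<Rightarrow> 'h) \<Rightarrow> bool" where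
  "unitary_to_sum J l u \<longleftrightarrow>
     (\<forall>a b n. u (a + b) n = u a n + u b n) \<and>
     (\<forall>c a n. u (c *\<^sub>R a) n = c *\<^sub>R u a n) \<and>
     (\<forall>v n. u (blinfun_apply J v) n = blinfun_apply J (u v n)) \<and>
     (\<forall>v n. \<not> enat n < l \<longrightarrow> u v n = 0) \<and>
     (\<forall>v. (\<lambda>n. (norm (u v n))^2) sums ((norm v)^2)) \<and>
     (\<forall>g. (\<forall>n. \<not> enat n < l \<longrightarrow> g n = 0) \<and> summable (\<lambda>n. (norm (g n))^2) \<longrightarrow> (\<exists>v. u v = g))"

definition nc_exhaustion :: "('h::real_normed_vector \<Rightarrow>\<^sub>L 'h) \<Rightarrow> (('h \<Rightarrow>\<^sub>L 'h)^'d) set \<Rightarrow>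
    (nat \<Rightarrow> (('h \<Rightarrow>\<^sub>L 'h)^'d) set) \<Rightarrow> bool" where
  "nc_exhaustion J \<Omega> \<Omega>k \<longleftrightarrow>
     \<Omega> = (\<Union>k. \<Omega>k k) \<and>
     (\<forall>k. \<forall>x\<in>\<Omega>k k. \<exists>e>0. \<forall>y\<in>BH J. tnorm (y - x) < e \<longrightarrow> y \<in> \<Omega>k (Suc k)) \<and>
     (\<forall>k. \<exists>R. \<forall>x\<in>\<Omega>k k. tnorm x \<le> R) \<and>
     (\<forall>k. unit_inv J (\<Omega>k k)) \<and>
     (\<forall>k l x. l \<ge> 1 \<and> (\<forall>n. enat n < l \<longrightarrow> x n \<in> \<Omega>k k) \<longrightarrow>
        (\<exists>u. unitary_to_sum J l u \<and>
           (\<exists>y\<in>\<Omega>k k. \<forall>i v. u (blinfun_apply (y$i) v) = (\<lambda>n. blinfun_apply (x n $ i) (u v n)))))"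

definition nc_domain :: "('h::real_normed_vector \<Rightarrow>\<^sub>L 'h) \<Rightarrow> (('h \<Rightarrow>\<^sub>L 'h)^'d) set \<Rightarrow> bool" where
  "nc_domain J \<Omega> \<longleftrightarrow> \<Omega> \<subseteq> BH J \<and> (\<exists>\<Omega>k. nc_exhaustion J \<Omega> \<Omega>k)"

definition sot_closed :: "('h::real_normed_vector \<Rightarrow>\<^sub>L 'h) \<Rightarrow> (('h \<Rightarrow>\<^sub>L 'h)^'d) set \<Rightarrow> bool" where
  "sot_closed J S \<longleftrightarrow> (\<forall>x\<in>BH J.
     (\<forall>F e. finite F \<and> e > 0 \<longrightarrow>
        (\<exists>y\<in>S. \<forall>i. \<forall>v\<in>F. norm (blinfun_apply (x$i) v - blinfun_apply (y$i) v) < e)) \<longrightarrow> x \<in> S)"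

definition strong_exhaustion :: "('h::real_normed_vector \<Rightarrow>\<^sub>L 'h) \<Rightarrow> (('h \<Rightarrow>\<^sub>L 'h)^'d) set \<Rightarrow>
    (nat \<Rightarrow> (('h \<Rightarrow>\<^sub>L 'h)^'d) set) \<Rightarrow> bool" where
  "strong_exhaustion J \<Omega> \<Omega>k \<longleftrightarrow> nc_exhaustion J \<Omega> \<Omega>k \<and>
     (\<forall>k. sot_closed J (\<Omega>k k)) \<and>
     (\<forall>k. \<exists>\<epsilon>>0. \<forall>x\<in>BH J. (\<exists>y\<in>\<Omega>k k. tnorm (x - y) < \<epsilon>) \<longrightarrow> x \<in> \<Omega>k (Suc k))"

definition sot_cont_on :: "(('h::real_normed_vector \<Rightarrow>\<^sub>L 'h)^'d) set \<Rightarrow>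
    (('h \<Rightarrow>\<^sub>L 'h)^'d \<Rightarrow> ('h \<Rightarrow>\<^sub>L 'h)^'r) \<Rightarrow> bool" where
  "sot_cont_on S f \<longleftrightarrow> (\<forall>x\<in>S. \<forall>F e. finite F \<and> e > 0 \<longrightarrow>
     (\<exists>G \<delta>. finite G \<and> \<delta> > 0 \<and>
        (\<forall>y\<in>S. (\<forall>i. \<forall>v\<in>G. norm (blinfun_apply (y$i) v - blinfun_apply (x$i) v) < \<delta>) \<longrightarrow>
           (\<forall>j. \<forall>v\<in>F. norm (blinfun_apply (f y $ j) v - blinfun_apply (f x $ j) v) < e))))"

definition cbl2 :: "('h::real_normed_vector \<Rightarrow>\<^sub>L 'h) \<Rightarrow> ('h \<Rightarrow>\<^sub>L ('h \<times> 'h)) \<Rightarrow> bool" where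
  "cbl2 J s \<longleftrightarrow> (\<forall>v. blinfun_apply s (blinfun_apply J v) =
      (blinfun_apply J (fst (blinfun_apply s v)), blinfun_apply J (snd (blinfun_apply s v))))"

definition nc_function :: "('h::real_normed_vector \<Rightarrow>\<^sub>L 'h) \<Rightarrow> (('h \<Rightarrow>\<^sub>L 'h)^'d) set \<Rightarrow>
    (('h \<Rightarrow>\<^sub>L 'h)^'d \<Rightarrow> ('h \<Rightarrow>\<^sub>L 'h)^'r) \<Rightarrow> bool" where
  "nc_function J \<Omega> f \<longleftrightarrow> nc_domain J \<Omega> \<and> (\<forall>x\<in>\<Omega>. f x \<in> BH J) \<and>
     (\<forall>x\<in>\<Omega>. \<forall>y\<in>\<Omega>. \<forall>s. cbl2 J s \<and> bij (blinfun_apply s) \<longrightarrow>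
       (\<forall>z\<in>\<Omega>. (\<forall>i v. blinfun_apply s (blinfun_apply (z$i) v) =
                  (blinfun_apply (x$i) (fst (blinfun_apply s v)), blinfun_apply (y$i) (snd (blinfun_apply s v))))
         \<longrightarrow> (\<forall>j v. blinfun_apply s (blinfun_apply (f z $ j) v) =
                  (blinfun_apply (f x $ j) (fst (blinfun_apply s v)), blinfun_apply (f y $ j) (snd (blinfun_apply s v))))))"

definition strong_nc_function :: "('h::real_normed_vector \<Rightarrow>\<^sub>L 'h) \<Rightarrow> (('h \<Rightarrow>\<^sub>L 'h)^'d) set \<Rightarrow>
    (('h \<Rightarrow>\<^sub>L 'h)^'d \<Rightarrow> ('h \<Rightarrow>\<^sub>L 'h)^'r) \<Rightarrow> bool" where
  "strong_nc_function J \<Omega> f \<longleftrightarrow> nc_function J \<Omega> f \<and>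
     (\<exists>\<Omega>k. strong_exhaustion J \<Omega> \<Omega>k \<and> (\<forall>k. sot_cont_on (\<Omega>k k) f))"

definition has_fderiv :: "('h::real_normed_vector \<Rightarrow>\<^sub>L 'h) \<Rightarrow> (('h \<Rightarrow>\<^sub>L 'h)^'d) set \<Rightarrow>
    (('h \<Rightarrow>\<^sub>L 'h)^'d \<Rightarrow> ('h \<Rightarrow>\<^sub>L 'h)^'r) \<Rightarrow> ('h \<Rightarrow>\<^sub>L 'h)^'d \<Rightarrow>
    (('h \<Rightarrow>\<^sub>L 'h)^'d \<Rightarrow> ('h \<Rightarrow>\<^sub>L 'h)^'r) \<Rightarrow> bool" where
  "has_fderiv J \<Omega> f x L \<longleftrightarrow>
     (\<forall>h\<in>BH J. L h \<in> BH J) \<and>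
     (\<forall>h\<in>BH J. \<forall>k\<in>BH J. L (h + k) = L h + L k) \<and>
     (\<forall>c. \<forall>h\<in>BH J. L (cscaleT J c h) = cscaleT J c (L h)) \<and>
     (\<exists>K. \<forall>h\<in>BH J. tnorm (L h) \<le> K * tnorm h) \<and>
     (\<forall>e>0. \<exists>\<delta>>0. \<forall>h\<in>BH J. tnorm h < \<delta> \<and> x + h \<in> \<Omega> \<longrightarrow>
        tnorm (f (x + h) - f x - L h) \<le> e * tnorm h)"

definition bounded_below_on :: "(('h::real_normed_vector \<Rightarrow>\<^sub>L 'h)^'d) set \<Rightarrow>
    (('h \<Rightarrow>\<^sub>L 'h)^'d \<Rightarrow> ('h \<Rightarrow>\<^sub>L 'h)^'r) \<Rightarrow> bool" where
  "bounded_below_on V L \<longleftrightarrow> (\<exists>C>0. \<forall>h\<in>V. C * tnorm h \<le> tnorm (L h))"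

end

theory Submission
  imports Defs "HOL-Library.Diagonal_Subsequence"
begin

text \<open>
  If \<open>Df(x)\<close> is not bounded below, choose \<open>\<parallel>h\<^sub>n\<parallel> = 1\<close> with \<open>Df(x)h\<^sub>n \<rightarrow> 0\<close>. Any bounded sequence of tuples can be
  conjugated by unitaries so that every vector of a dense sequence is mapped into a compact set
  independent of \<open>n\<close>; hence, along a subsequence, the conjugates of \<open>(x, h\<^sub>n)\<close> converge strongly to some
  \<open>(y, h)\<close>, and sending a vector almost norming \<open>h\<^sub>n\<close> to a fixed line keeps \<open>h \<noteq> 0\<close>. Since \<open>Df\<close> is
  the upper right corner of \<open>f\<close> at a \<open>2 \<times> 2\<close> upper triangular point, strong continuity of \<open>f\<close> on the
  strongly closed sets \<open>\<Omega>\<^sub>k\<close> gives \<open>Df(y)h = 0\<close>, contradicting injectivity at \<open>y\<close>.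
\<close>

subsection \<open>Tuples of operators and splittings\<close>

text \<open>The continuity assumed of \<open>f\<close> is strong, but a bounded sequence of
  operators may have no strong limit point: powers of a unilateral shift have none. Strong
  convergence only asks that, for each vector \<open>d j\<close> of a dense sequence, the images
  stay in a compact set. After conjugation this set is a ball of a finite-dimensional space whose
  index depends on \<open>j\<close> and on the number of operators, but not on \<open>n\<close>;
  infinite dimension always leaves a fresh direction to rotate into. The price is that the fixed
  \<open>x\<close> becomes a moving sequence, whose limit \<open>y\<close> is in general another
  point, so injectivity is needed away from \<open>x\<close>. All conjugates and \<open>y\<close>
  stay in one set \<open>\<Omega>k k\<close>, on which radii and bounds are uniform. Strong
  continuity says nothing about difference quotients. The triangular point turns
  \<open>Df(x)h\<close>, for small \<open>h\<close>, into a compression of a single value of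
  \<open>f\<close>, which does pass to the limit. That this corner is linear and bounded and is the
  derivative follows from one principle: \<open>f\<close> respects every operator intertwining two
  points, invertible or not.\<close>

lemma blinfun_eq_iff: "S = T \<longleftrightarrow> (\<forall>v. blinfun_apply S v = blinfun_apply T v)"
  by (auto intro: blinfun_eqI)

lemma component_le_tnorm: "norm (x $ i) \<le> tnorm x"
  unfolding tnorm_def by (rule Max_ge) auto

lemma tnorm_le_iff: "tnorm x \<le> c \<longleftrightarrow> (\<forall>i. norm (x $ i) \<le> c)"
  unfolding tnorm_def by (subst Max_le_iff) auto

lemma tnorm_attained: "\<exists>i. tnorm x = norm (x $ i)"
proof -
  have "tnorm x \<in> range (\<lambda>i. norm (x $ i))"
    unfolding tnorm_def by (rule Max_in) auto
  thus ?thesis by auto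
qed

lemma tnorm_nonneg [simp]: "0 \<le> tnorm x"
  using component_le_tnorm[of x undefined] norm_ge_zero order_trans by blast

lemma tnorm_zero [simp]: "tnorm 0 = 0"
  by (rule antisym) (auto simp: tnorm_le_iff)

lemma tnorm_eq_0_iff: "tnorm x = 0 \<longleftrightarrow> x = 0"
  using component_le_tnorm[of x] by (auto simp: vec_eq_iff intro: antisym simp: tnorm_le_iff)

lemma tnorm_diff_triangle: "tnorm (x - y) \<le> tnorm x + tnorm y"
  unfolding tnorm_le_iff
  by (auto intro!: order_trans[OF norm_triangle_ineq4] add_mono component_le_tnorm)

lemma tnorm_scaleR: "tnorm (c *\<^sub>R x) = \<bar>c\<bar> * tnorm x"
proof (rule antisym)
  show "tnorm (c *\<^sub>R x) \<le> \<bar>c\<bar> * tnorm x"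
    unfolding tnorm_le_iff by (auto intro!: mult_left_mono component_le_tnorm)
  obtain i where "tnorm x = norm (x $ i)" using tnorm_attained by blast
  thus "\<bar>c\<bar> * tnorm x \<le> tnorm (c *\<^sub>R x)"
    using component_le_tnorm[of "c *\<^sub>R x" i] by simp
qed

lemma tnorm_compose_le:
  fixes h :: "('h::real_normed_vector \<Rightarrow>\<^sub>L 'h)^'d"
  assumes S: "\<And>v. norm (blinfun_apply S v) \<le> norm v" and R: "\<And>v. norm (blinfun_apply R v) \<le> norm v"
  shows "tnorm (\<chi> i. S o\<^sub>L h$i o\<^sub>L R) \<le> tnorm h"
  unfolding tnorm_le_iff
proof
  fix i
  have "norm (S o\<^sub>L h$i o\<^sub>L R) \<le> norm (h$i)"
  proof (rule norm_blinfun_bound)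
    fix v
    have "norm (S ((h$i) (R v))) \<le> norm ((h$i) (R v))" by (rule S)
    also have "\<dots> \<le> norm (h$i) * norm (R v)" by (rule norm_blinfun)
    also have "\<dots> \<le> norm (h$i) * norm v" by (intro mult_left_mono R) auto
    finally show "norm ((S o\<^sub>L h$i o\<^sub>L R) v) \<le> norm (h$i) * norm v" by simp
  qed auto
  thus "norm ((\<chi> i. S o\<^sub>L h$i o\<^sub>L R) $ i) \<le> tnorm h"
    using component_le_tnorm[of h i] by simp
qed

lemma cbl_iff: "cbl J T \<longleftrightarrow> (\<forall>v. T (J v) = J (T v))"
  unfolding cbl_def by (auto simp: blinfun_eq_iff)

lemma BH_apply: "x \<in> BH J \<Longrightarrow> (x $ i) (J v) = J ((x $ i) v)"
  by (auto simp: BH_def cbl_iff)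

lemma BH_iff: "x \<in> BH J \<longleftrightarrow> (\<forall>i v. (x $ i) (J v) = J ((x $ i) v))"
  by (auto simp: BH_def cbl_iff)

lemma BH_add: "x \<in> BH J \<Longrightarrow> y \<in> BH J \<Longrightarrow> x + y \<in> BH J"
  by (simp add: BH_iff blinfun.add_left blinfun.add_right)

lemma BH_diff: "x \<in> BH J \<Longrightarrow> y \<in> BH J \<Longrightarrow> x - y \<in> BH J"
  by (simp add: BH_iff blinfun.diff_left blinfun.diff_right)

lemma BH_scaleR: "x \<in> BH J \<Longrightarrow> c *\<^sub>R x \<in> BH J"
  by (simp add: BH_iff blinfun.scaleR_left blinfun.scaleR_right)

lemma BH_zero: "0 \<in> BH J"
  by (simp add: BH_iff)

lemma BH_cscaleT: "x \<in> BH J \<Longrightarrow> cscaleT J c x \<in> BH J"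
  by (simp add: BH_iff cscaleT_def blinfun.bilinear_simps)

lemma cscaleT_of_real: "cscaleT J (of_real t) x = t *\<^sub>R x"
  by (simp add: cscaleT_def vec_eq_iff)

lemmas bl_simps = blinfun.bilinear_simps

section \<open>Coordinates of a unitary onto a Hilbert sum\<close>

lemma unitary_to_sum_inj:
  assumes u: "unitary_to_sum J l u" and eq: "u v = u w"
  shows "v = w"
proof -
  have "u (v + (-1) *\<^sub>R w) m = u v m + (-1) *\<^sub>R u w m" for m
    using u unfolding unitary_to_sum_def by metis
  then have "u (v - w) m = 0" for m using eq by simp
  moreover have "(\<lambda>n. (norm (u (v - w) n))^2) sums ((norm (v - w))^2)"
    using u unfolding unitary_to_sum_def by auto
  ultimately have "(\<lambda>n. 0::real) sums ((norm (v - w))^2)" by simp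
  then have "(norm (v - w))^2 = 0" using sums_0 sums_unique2 by blast
  thus ?thesis by simp
qed

text \<open>Replaces the sequence-valued \<open>u\<close> by bounded operators on \<open>H\<close>:
  \<open>P\<close> reads off the \<open>n\<close>-th coordinate and \<open>A\<close> embeds the
  \<open>n\<close>-th copy. \<open>A\<close> exists because \<open>u\<close> is onto, and it is
  linear and commutes with \<open>J\<close> because \<open>u\<close> is injective.\<close>

lemma unitary_to_sum_coordinate:
  fixes u :: "'h::real_normed_vector \<Rightarrow> nat \<Rightarrow> 'h"
  assumes u: "unitary_to_sum J l u" and n: "enat n < l"
  obtains P A where "cbl J P" "cbl J A" "\<And>v. blinfun_apply P v = u v n"
    "\<And>v. u (blinfun_apply A v) = (\<lambda>m. if m = n then v else 0)"
    "\<And>v. norm (blinfun_apply A v) = norm v" "\<And>v. norm (blinfun_apply P v) \<le> norm v"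
proof -
  have add: "u (a + b) m = u a m + u b m" and sc: "u (c *\<^sub>R a) m = c *\<^sub>R u a m"
    and J: "u (J a) m = J (u a m)" for a b c m
    using u unfolding unitary_to_sum_def by auto
  have sums: "(\<lambda>n. (norm (u v n))^2) sums ((norm v)^2)" for v
    using u unfolding unitary_to_sum_def by auto
  have surj: "\<exists>v. u v = g"
    if "\<And>n. \<not> enat n < l \<Longrightarrow> g n = 0" "summable (\<lambda>n. (norm (g n))^2)" for g
    using u that unfolding unitary_to_sum_def by blast
  note inj = unitary_to_sum_inj[OF u]
  have le: "norm (u v n) \<le> norm v" for v
  proof -
    have "(\<Sum>m\<in>{n}. (norm (u v m))^2) \<le> (\<Sum>m. (norm (u v m))^2)"
      by (rule sum_le_suminf) (use sums[of v] in \<open>auto simp: sums_iff\<close>)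
    also have "\<dots> = (norm v)^2" using sums[of v] by (simp add: sums_iff)
    finally show ?thesis by (simp add: power2_le_iff_abs_le)
  qed
  define \<delta> :: "'h \<Rightarrow> nat \<Rightarrow> 'h" where "\<delta> = (\<lambda>v m. if m = n then v else 0)"
  have \<delta>sums: "(\<lambda>m. (norm (\<delta> v m))^2) sums (norm v)^2" for v
  proof -
    have "(\<lambda>m. (norm (\<delta> v m))^2) sums (\<Sum>m\<in>{n}. (norm (\<delta> v m))^2)"
      by (rule sums_finite) (auto simp: \<delta>_def)
    thus ?thesis by (simp add: \<delta>_def)
  qed
  have "\<exists>a. u a = \<delta> v" for v
    by (rule surj) (use n \<delta>sums[of v] in \<open>auto simp: \<delta>_def sums_iff\<close>)
  then obtain a where a: "\<And>v. u (a v) = \<delta> v" by metis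
  have na: "norm (a v) = norm v" for v
    using sums[of "a v"] \<delta>sums[of v] unfolding a using sums_unique2 by force
  have lin_a: "bounded_linear a"
    by (rule bounded_linear_intro[where K = 1])
       (auto intro!: inj simp: a fun_eq_iff add sc na \<delta>_def)
  have Ja: "a (J v) = J (a v)" for v
    by (rule inj) (auto simp: a fun_eq_iff J \<delta>_def)
  have lin_p: "bounded_linear (\<lambda>v. u v n)"
    by (rule bounded_linear_intro[where K = 1]) (auto simp: add sc le)
  show ?thesis
    by (rule that[of "Blinfun (\<lambda>v. u v n)" "Blinfun a"])
       (auto simp: bounded_linear_Blinfun_apply lin_a lin_p cbl_iff Ja J a \<delta>_def na le fun_eq_iff)
qed

lemma strong_exhaustion_direct_sum:
  assumes exh: "strong_exhaustion J \<Omega> \<Omega>k"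
    and "l \<ge> 1" and "\<And>n. enat n < l \<Longrightarrow> x n \<in> \<Omega>k k"
  obtains u y where "unitary_to_sum J l u" "y \<in> \<Omega>k k"
    "\<And>i v. u (blinfun_apply (y$i) v) = (\<lambda>n. blinfun_apply (x n $ i) (u v n))"
proof -
  have "\<forall>k l x. l \<ge> 1 \<and> (\<forall>n. enat n < l \<longrightarrow> x n \<in> \<Omega>k k) \<longrightarrow>
        (\<exists>u. unitary_to_sum J l u \<and>
           (\<exists>y\<in>\<Omega>k k. \<forall>i v. u (blinfun_apply (y$i) v) = (\<lambda>n. blinfun_apply (x n $ i) (u v n))))"
    using exh unfolding strong_exhaustion_def nc_exhaustion_def by (elim conjE)
  from this[rule_format, of l x k] assms(2,3)
  obtain u y where "unitary_to_sum J l u" "y \<in> \<Omega>k k"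
    "\<forall>i v. u (blinfun_apply (y$i) v) = (\<lambda>n. blinfun_apply (x n $ i) (u v n))"
    by auto
  then show thesis using that by simp
qed

text \<open>A unitary \<open>H \<rightarrow> H \<oplus> H\<close> given by its two components and the two components of its inverse.\<close>

locale splitting =
  fixes J P Q A B :: "'h::real_normed_vector \<Rightarrow>\<^sub>L 'h"
  assumes PJ: "P (J v) = J (P v)" and QJ: "Q (J v) = J (Q v)"
    and AJ: "A (J v) = J (A v)" and BJ: "B (J v) = J (B v)"
    and PA [simp]: "P (A v) = v" and QB [simp]: "Q (B v) = v"
    and PB [simp]: "P (B v) = 0" and QA [simp]: "Q (A v) = 0"
    and AP_BQ: "A (P v) + B (Q v) = v"
    and pyth: "(norm (P v))^2 + (norm (Q v))^2 = (norm v)^2"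
begin

lemma norm_A [simp]: "norm (A v) = norm v"
  using pyth[of "A v"] by simp

lemma norm_B [simp]: "norm (B v) = norm v"
  using pyth[of "B v"] by simp

lemma norm_P: "norm (P v) \<le> norm v"
proof (rule power2_le_imp_le)
  show "(norm (P v))^2 \<le> (norm v)^2"
    using pyth[of v] zero_le_power2[of "norm (P v)"] zero_le_power2[of "norm (Q v)"] by linarith
qed auto

lemma norm_Q: "norm (Q v) \<le> norm v"
proof (rule power2_le_imp_le)
  show "(norm (Q v))^2 \<le> (norm v)^2"
    using pyth[of v] zero_le_power2[of "norm (P v)"] zero_le_power2[of "norm (Q v)"] by linarith
qed auto

end

lemma unitary_to_sum_2_splitting:
  fixes u :: "'h::real_normed_vector \<Rightarrow> nat \<Rightarrow> 'h"
  assumes u: "unitary_to_sum J 2 u"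
  obtains P Q A B where "splitting J P Q A B"
    "\<And>v. blinfun_apply P v = u v 0" "\<And>v. blinfun_apply Q v = u v 1"
proof -
  have 01: "enat 0 < 2" "enat 1 < 2" and ge2: "\<not> enat n < 2 \<longleftrightarrow> n \<ge> 2" for n
    by (auto simp: numeral_eq_enat)
  obtain P A where PA: "cbl J P" "cbl J A" "\<And>v. blinfun_apply P v = u v 0"
    "\<And>v. u (blinfun_apply A v) = (\<lambda>m. if m = 0 then v else 0)"
    using unitary_to_sum_coordinate[OF u 01(1)] by metis
  obtain Q B where QB: "cbl J Q" "cbl J B" "\<And>v. blinfun_apply Q v = u v 1"
    "\<And>v. u (blinfun_apply B v) = (\<lambda>m. if m = 1 then v else 0)"
    using unitary_to_sum_coordinate[OF u 01(2)] by metis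
  have add: "u (a + b) m = u a m + u b m" and zero: "m \<ge> 2 \<Longrightarrow> u a m = 0" for a b m
    using u unfolding unitary_to_sum_def by (auto simp: ge2[symmetric])
  have sums: "(\<lambda>n. (norm (u v n))^2) sums ((norm v)^2)" for v
    using u unfolding unitary_to_sum_def by auto
  have pyth: "(norm (u v 0))^2 + (norm (u v 1))^2 = (norm v)^2" for v
  proof -
    have "(\<lambda>n. (norm (u v n))^2) sums (\<Sum>n\<in>{0,1}. (norm (u v n))^2)"
      by (rule sums_finite) (auto simp: zero)
    thus ?thesis using sums[of v] sums_unique2 by force
  qed
  have AB: "A (P v) + B (Q v) = v" for v
  proof (rule unitary_to_sum_inj[OF u], rule ext)
    fix m show "u (A (P v) + B (Q v)) m = u v m"
      using zero[of m v] by (cases "m = 0"; cases "m = 1") (auto simp: add PA QB)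
  qed
  have "splitting J P Q A B"
    using PA(1,2) QB(1,2) AB pyth by unfold_locales (auto simp: cbl_iff PA(3,4) QB(3,4))
  thus ?thesis using that PA(3) QB(3) by blast
qed

subsection \<open>Calculus of NC functions\<close>

text \<open>The upper triangular \<open>2 \<times> 2\<close> matrix with diagonal \<open>x\<close>, \<open>y\<close> and corner \<open>h\<close>, read in \<open>H\<close> through the splitting.\<close>

definition block :: "('h::real_normed_vector \<Rightarrow>\<^sub>L 'h) \<Rightarrow> ('h \<Rightarrow>\<^sub>L 'h) \<Rightarrow> ('h \<Rightarrow>\<^sub>L 'h) \<Rightarrow> ('h \<Rightarrow>\<^sub>L 'h) \<Rightarrow>
    ('h \<Rightarrow>\<^sub>L 'h)^'d \<Rightarrow> ('h \<Rightarrow>\<^sub>L 'h)^'d \<Rightarrow> ('h \<Rightarrow>\<^sub>L 'h)^'d \<Rightarrow> ('h \<Rightarrow>\<^sub>L 'h)^'d" where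
  "block P Q A B x h y =
    (\<chi> i. (A o\<^sub>L x$i o\<^sub>L P) + (A o\<^sub>L h$i o\<^sub>L Q) + (B o\<^sub>L y$i o\<^sub>L Q))"

locale nc_calculus = splitting J P Q A B
  for J P Q A B :: "'h::real_normed_vector \<Rightarrow>\<^sub>L 'h" +
  fixes \<Omega> :: "(('h \<Rightarrow>\<^sub>L 'h)^'d) set"
    and f :: "('h \<Rightarrow>\<^sub>L 'h)^'d \<Rightarrow> ('h \<Rightarrow>\<^sub>L 'h)^'r"
    and \<Omega>k
  assumes nc: "nc_function J \<Omega> f" and exh: "strong_exhaustion J \<Omega> \<Omega>k"
begin

abbreviation Z where "Z \<equiv> block P Q A B"

lemma Z_apply: "(Z x h y $ i) v = A ((x$i) (P v)) + A ((h$i) (Q v)) + B ((y$i) (Q v))"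
  by (simp add: block_def bl_simps)

definition ncdiff :: "('h \<Rightarrow>\<^sub>L 'h)^'d \<Rightarrow> ('h \<Rightarrow>\<^sub>L 'h)^'d \<Rightarrow> ('h \<Rightarrow>\<^sub>L 'h)^'d \<Rightarrow> ('h \<Rightarrow>\<^sub>L 'h)^'r" where
  "ncdiff x y h = (\<chi> j. P o\<^sub>L (f (Z x h y) $ j) o\<^sub>L B)"

lemma ncdiff_apply: "(ncdiff x y h $ j) v = P ((f (Z x h y) $ j) (B v))"
  by (simp add: ncdiff_def)

lemma \<Omega>_eq: "\<Omega> = (\<Union>k. \<Omega>k k)"
  using exh unfolding strong_exhaustion_def nc_exhaustion_def by blast

lemma \<Omega>k_\<Omega>: "x \<in> \<Omega>k k \<Longrightarrow> x \<in> \<Omega>"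
  using \<Omega>_eq by blast

lemma \<Omega>_BH: "x \<in> \<Omega> \<Longrightarrow> x \<in> BH J"
  using nc unfolding nc_function_def nc_domain_def by blast

lemma \<Omega>k_BH: "x \<in> \<Omega>k k \<Longrightarrow> x \<in> BH J"
  using \<Omega>_BH \<Omega>k_\<Omega> by blast

lemma f_BH: "x \<in> \<Omega> \<Longrightarrow> f x \<in> BH J"
  using nc unfolding nc_function_def by blast

lemma eps: obtains \<epsilon> where "\<epsilon> > 0" "\<And>x y. x \<in> BH J \<Longrightarrow> y \<in> \<Omega>k k \<Longrightarrow> tnorm (x - y) < \<epsilon> \<Longrightarrow> x \<in> \<Omega>k (Suc k)"
  using exh unfolding strong_exhaustion_def by metis

lemma \<Omega>k_Suc: "x \<in> \<Omega>k k \<Longrightarrow> x \<in> \<Omega>k (Suc k)"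
proof -
  assume x: "x \<in> \<Omega>k k"
  obtain \<epsilon> where "\<epsilon> > 0" "\<And>x y. x \<in> BH J \<Longrightarrow> y \<in> \<Omega>k k \<Longrightarrow> tnorm (x - y) < \<epsilon> \<Longrightarrow> x \<in> \<Omega>k (Suc k)"
    using eps by metis
  from this(2)[OF \<Omega>k_BH[OF x] x] this(1) show ?thesis by simp
qed

lemma \<Omega>k_mono: "i \<le> k \<Longrightarrow> x \<in> \<Omega>k i \<Longrightarrow> x \<in> \<Omega>k k"
  by (induction k rule: dec_induct) (auto intro: \<Omega>k_Suc)

lemmas direct_sum = strong_exhaustion_direct_sum[OF exh]

lemma unit_inv: "unit_inv J (\<Omega>k k)"
  using exh unfolding strong_exhaustion_def nc_exhaustion_def by blast

text \<open>The exhaustion puts \<open>x\<close> and \<open>y\<close> together through some unitary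
  of its own choice, while \<open>Z\<close> uses the fixed splitting. Two splittings differ by a
  unitary of \<open>H\<close>, and \<open>\<Omega>k k\<close> is unitarily invariant.\<close>

lemma Z_diag:
  assumes x: "x \<in> \<Omega>k k" and y: "y \<in> \<Omega>k k"
  shows "Z x 0 y \<in> \<Omega>k k"
proof -
  obtain u z where u: "unitary_to_sum J 2 u" and z: "z \<in> \<Omega>k k"
    and uz: "\<And>i v. u (blinfun_apply (z$i) v) = (\<lambda>n. blinfun_apply ((if n = 0 then x else y) $ i) (u v n))"
    by (rule direct_sum[of 2 "\<lambda>n. if n = 0 then x else y" k]) (auto simp: x y numeral_eq_enat one_enat_def)
  obtain P' Q' A' B' where s: "splitting J P' Q' A' B'"
    and P': "\<And>v. blinfun_apply P' v = u v 0" and Q': "\<And>v. blinfun_apply Q' v = u v 1"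
    using unitary_to_sum_2_splitting[OF u] by metis
  interpret s: splitting J P' Q' A' B' by (rule s)
  have Pz: "P' ((z$i) v) = (x$i) (P' v)" and Qz: "Q' ((z$i) v) = (y$i) (Q' v)" for i v
    by (simp_all add: P' Q' uz)
  define w where "w = (A' o\<^sub>L P) + (B' o\<^sub>L Q)"
  define w' where "w' = (A o\<^sub>L P') + (B o\<^sub>L Q')"
  have "cunitary J w w'"
    unfolding cunitary_def
  proof (intro conjI allI)
    show "cbl J w"
      by (simp add: cbl_iff w_def bl_simps PJ QJ s.AJ s.BJ)
    show "w' o\<^sub>L w = id_blinfun"
      by (rule blinfun_eqI) (simp add: w_def w'_def bl_simps AP_BQ)
    show "w o\<^sub>L w' = id_blinfun"
      by (rule blinfun_eqI) (simp add: w_def w'_def bl_simps s.AP_BQ)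
    fix v
    show "norm (w v) = norm v"
    proof (rule power2_eq_imp_eq)
      show "(norm (w v))^2 = (norm v)^2"
        using s.pyth[of "w v"] pyth[of v] by (simp add: w_def bl_simps)
    qed auto
  qed
  then have "(\<chi> i. w' o\<^sub>L z$i o\<^sub>L w) \<in> \<Omega>k k"
    using unit_inv z unfolding unit_inv_def by blast
  also have "(\<chi> i. w' o\<^sub>L z$i o\<^sub>L w) = Z x 0 y"
    by (auto simp: vec_eq_iff blinfun_eq_iff Z_apply w_def w'_def bl_simps Pz Qz)
  finally show ?thesis .
qed

lemma Z_BH: "x \<in> BH J \<Longrightarrow> h \<in> BH J \<Longrightarrow> y \<in> BH J \<Longrightarrow> Z x h y \<in> BH J"
  by (simp add: BH_iff Z_apply bl_simps PJ QJ AJ BJ)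

lemma tnorm_AhQ: "tnorm (\<chi> i. A o\<^sub>L h$i o\<^sub>L Q) \<le> tnorm h"
  by (rule tnorm_compose_le) (simp_all add: norm_Q)

lemma tnorm_AhP: "tnorm (\<chi> i. A o\<^sub>L h$i o\<^sub>L P) \<le> tnorm h"
  by (rule tnorm_compose_le) (simp_all add: norm_P)

lemma tnorm_PhB: "tnorm (\<chi> i. P o\<^sub>L h$i o\<^sub>L B) \<le> tnorm h"
  by (rule tnorm_compose_le) (simp_all add: norm_P)

text \<open>The corner moves the diagonal point, which lies in \<open>\<Omega>k k\<close>, by at
  most \<open>tnorm h\<close>. One radius therefore serves the whole of \<open>\<Omega>k k\<close>;
  this uniformity is what later covers all conjugates of \<open>x\<close> and their limit at
  once.\<close>

lemma eps_Z: obtains \<epsilon> where "\<epsilon> > 0"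
  "\<And>x y h. x \<in> \<Omega>k k \<Longrightarrow> y \<in> \<Omega>k k \<Longrightarrow> h \<in> BH J \<Longrightarrow> tnorm h < \<epsilon> \<Longrightarrow> Z x h y \<in> \<Omega>k (Suc k)"
  "\<And>x h. x \<in> \<Omega>k k \<Longrightarrow> h \<in> BH J \<Longrightarrow> tnorm h < \<epsilon> \<Longrightarrow> x + h \<in> \<Omega>k (Suc k)"
proof -
  obtain \<epsilon> where \<epsilon>: "\<epsilon> > 0" "\<And>x y. x \<in> BH J \<Longrightarrow> y \<in> \<Omega>k k \<Longrightarrow> tnorm (x - y) < \<epsilon> \<Longrightarrow> x \<in> \<Omega>k (Suc k)"
    using eps by metis
  show thesis
  proof (rule that[OF \<epsilon>(1)])
    fix x y h :: "('h \<Rightarrow>\<^sub>L 'h)^'d" assume *: "x \<in> \<Omega>k k" "y \<in> \<Omega>k k" "h \<in> BH J" "tnorm h < \<epsilon>"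
    have "Z x h y - Z x 0 y = (\<chi> i. A o\<^sub>L h$i o\<^sub>L Q)"
      by (auto simp: vec_eq_iff blinfun_eq_iff Z_apply bl_simps)
    then have "tnorm (Z x h y - Z x 0 y) < \<epsilon>" using tnorm_AhQ[of h] * by simp
    moreover have "Z x h y \<in> BH J" using * by (intro Z_BH) (auto intro: \<Omega>k_BH)
    ultimately show "Z x h y \<in> \<Omega>k (Suc k)" using \<epsilon>(2) Z_diag * by blast
  next
    fix x h :: "('h \<Rightarrow>\<^sub>L 'h)^'d" assume "x \<in> \<Omega>k k" "h \<in> BH J" "tnorm h < \<epsilon>"
    then show "x + h \<in> \<Omega>k (Suc k)" by (intro \<epsilon>(2)[of _ x]) (auto intro: BH_add \<Omega>k_BH)
  qed
qed

text \<open>The invertible operators with block matrices \<open>1\<close> and \<open>1\<close> plus \<open>T\<close> in the upper right corner,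
  conjugate \<open>x \<oplus> y\<close> to the same point.\<close>

lemma intertwining:
  assumes x: "x \<in> \<Omega>" and y: "y \<in> \<Omega>" and T: "cbl J T"
    and xy: "\<And>i v. T ((y$i) v) = (x$i) (T v)"
  shows "T ((f y $ j) v) = (f x $ j) (T v)"
proof -
  obtain k1 k2 where "x \<in> \<Omega>k k1" "y \<in> \<Omega>k k2" using x y \<Omega>_eq by auto
  then have xk: "x \<in> \<Omega>k (max k1 k2)" and yk: "y \<in> \<Omega>k (max k1 k2)"
    using \<Omega>k_mono by (meson max.cobounded1 max.cobounded2)+
  define z where "z = Z x 0 y"
  have z: "z \<in> \<Omega>" using Z_diag[OF xk yk] \<Omega>k_\<Omega> unfolding z_def by blast
  have Pz: "P ((z$i) v) = (x$i) (P v)" and Qz: "Q ((z$i) v) = (y$i) (Q v)" for i v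
    by (simp_all add: z_def Z_apply bl_simps)
  have NC: "bij (blinfun_apply s) \<Longrightarrow> cbl2 J s \<Longrightarrow>
      (\<And>i v. s ((z$i) v) = ((x$i) (fst (s v)), (y$i) (snd (s v)))) \<Longrightarrow>
      s ((f z $ j) v) = ((f x $ j) (fst (s v)), (f y $ j) (snd (s v)))" for s j v
    using nc x y z unfolding nc_function_def by blast
  have key: "P ((f z $ j) v) + S (Q ((f z $ j) v)) = (f x $ j) (P v + S (Q v)) \<and>
      Q ((f z $ j) v) = (f y $ j) (Q v)"
    if SJ: "cbl J S" and S: "\<And>i v. S ((y$i) v) = (x$i) (S v)" for S j v
  proof -
    have bl: "bounded_linear (\<lambda>v. (P v + S (Q v), Q v))"
      by (intro bounded_linear_Pair bounded_linear_add
          bounded_linear_compose[OF blinfun.bounded_linear_right blinfun.bounded_linear_right]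
          blinfun.bounded_linear_right)
    define s where "s = Blinfun (\<lambda>v. (P v + S (Q v), Q v))"
    have s: "blinfun_apply s v = (P v + S (Q v), Q v)" for v
      unfolding s_def by (simp add: bounded_linear_Blinfun_apply[OF bl])
    have "bij (blinfun_apply s)"
    proof (rule o_bij)
      define t where "t = (\<lambda>p. A (fst p - S (snd p)) + B (snd p))"
      show "t \<circ> blinfun_apply s = id"
        by (auto simp: t_def s fun_eq_iff AP_BQ)
      show "blinfun_apply s \<circ> t = id"
        by (auto simp: t_def s fun_eq_iff bl_simps)
    qed
    moreover have "cbl2 J s"
      using SJ by (auto simp: cbl2_def s PJ QJ cbl_iff bl_simps)
    ultimately have "s ((f z $ j) v) = ((f x $ j) (fst (s v)), (f y $ j) (snd (s v)))"
      by (rule NC) (simp add: s Pz Qz S bl_simps)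
    thus ?thesis by (auto simp: s)
  qed
  \<comment> \<open>The choice \<open>S = 0\<close> shows that the second column of
    \<open>f z\<close> is that of the direct sum of \<open>f x\<close> and \<open>f y\<close>.
    Inserted in the identity for \<open>S = T\<close>, evaluated at \<open>B v\<close>, it leaves
    exactly the claim.\<close>
  have 0: "P ((f z $ j) (B v)) = 0" "Q ((f z $ j) (B v)) = (f y $ j) v"
    using key[of 0 j "B v"] by (simp_all add: cbl_iff bl_simps)
  have "P ((f z $ j) (B v)) + T (Q ((f z $ j) (B v))) = (f x $ j) (P (B v) + T (Q (B v)))"
    using key[of T j "B v"] T xy by blast
  thus ?thesis by (simp add: 0)
qed

text \<open>No bound on \<open>f\<close> is part of the definition of an NC function. If
  \<open>f\<close> were unbounded along a sequence in \<open>\<Omega>k k\<close>, the infinite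
  direct sum of that sequence would be a point \<open>y\<close> of \<open>\<Omega>k k\<close>, and
  each \<open>f (x n)\<close> is a compression of the one bounded tuple \<open>f y\<close>.\<close>

lemma f_bounded: obtains M where "M > 0" "\<And>x. x \<in> \<Omega>k k \<Longrightarrow> tnorm (f x) \<le> M"
proof -
  have "\<exists>M. \<forall>x\<in>\<Omega>k k. tnorm (f x) \<le> M"
  proof (rule ccontr)
    assume "\<nexists>M. \<forall>x\<in>\<Omega>k k. tnorm (f x) \<le> M"
    then have "\<forall>n::nat. \<exists>x\<in>\<Omega>k k. tnorm (f x) > real n" by (meson not_le)
    then obtain x where x: "\<And>n::nat. x n \<in> \<Omega>k k" "\<And>n. tnorm (f (x n)) > real n" by metis
    obtain u y where u: "unitary_to_sum J \<infinity> u" and y: "y \<in> \<Omega>k k"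
      and uy: "\<And>i v. u (blinfun_apply (y$i) v) = (\<lambda>n. blinfun_apply (x n $ i) (u v n))"
      by (rule direct_sum[of \<infinity> x k]) (use x in auto)
    have "tnorm (f (x n)) \<le> tnorm (f y)" for n
    proof -
      obtain p a where p: "cbl J p" "\<And>v. blinfun_apply p v = u v n"
        and a: "\<And>v. u (blinfun_apply a v) = (\<lambda>m. if m = n then v else 0)"
        "\<And>v. norm (blinfun_apply a v) = norm v" "\<And>v. norm (blinfun_apply p v) \<le> norm v"
        by (rule unitary_to_sum_coordinate[OF u, of n]) auto
      have *: "p ((f y $ j) v) = (f (x n) $ j) (p v)" for j v
        by (rule intertwining) (use x(1) y \<Omega>k_\<Omega> p uy in auto)
      show ?thesis unfolding tnorm_le_iff
      proof
        fix j
        have "norm (f (x n) $ j) \<le> norm (f y $ j)"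
        proof (rule norm_blinfun_bound)
          fix v
          have "p (a v) = v" by (simp add: p a)
          then have "norm ((f (x n) $ j) v) = norm (p ((f y $ j) (a v)))" by (simp add: *)
          also have "\<dots> \<le> norm ((f y $ j) (a v))" by (rule a)
          also have "\<dots> \<le> norm (f y $ j) * norm (a v)" by (rule norm_blinfun)
          finally show "norm ((f (x n) $ j) v) \<le> norm (f y $ j) * norm v" by (simp add: a)
        qed auto
        thus "norm (f (x n) $ j) \<le> tnorm (f y)" using component_le_tnorm order_trans by blast
      qed
    qed
    then have "real n < tnorm (f y)" for n using x(2)[of n] less_le_trans by blast
    thus False using reals_Archimedean2 by (metis less_asym)
  qed
  then obtain M where "\<forall>x\<in>\<Omega>k k. tnorm (f x) \<le> M" by blast
  then show thesis by (intro that[of "max M 1"]) force+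
qed

text \<open>The direct sum of \<open>T\<close> and the identity intertwines the two block points, so
  \<open>T\<close> acts on the first summand only. \<open>T\<close> may be a scalar or a coordinate
  projection: the former gives homogeneity, the latter additivity.\<close>

lemma ncdiff_natural:
  assumes "Z x h y \<in> \<Omega>" "Z x' h' y \<in> \<Omega>" "y \<in> BH J" and T: "cbl J T"
    and "\<And>i v. T ((x$i) v) = (x'$i) (T v)" "\<And>i v. T ((h$i) v) = (h'$i) v"
  shows "(ncdiff x' y h' $ j) v = T ((ncdiff x y h $ j) v)"
proof -
  define S where "S = (A o\<^sub>L T o\<^sub>L P) + (B o\<^sub>L Q)"
  have "S ((f (Z x h y) $ j) (B v)) = (f (Z x' h' y) $ j) (S (B v))"
  proof (rule intertwining)
    show "cbl J S" using T by (simp add: cbl_iff S_def bl_simps PJ QJ AJ BJ)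
  qed (use assms in \<open>simp_all add: S_def Z_apply bl_simps\<close>)
  then have "P (S ((f (Z x h y) $ j) (B v))) = P ((f (Z x' h' y) $ j) (S (B v)))" by simp
  moreover have "S (B v) = B v" "P (S w) = T (P w)" for w
    by (simp_all add: S_def bl_simps)
  ultimately show ?thesis by (simp add: ncdiff_apply)
qed

text \<open>Here \<open>T\<close> acts on both summands. With \<open>T\<close> unitary this says
  that the corner transforms by conjugation together with the point and the direction.\<close>

lemma ncdiff_conj:
  assumes "Z x h x \<in> \<Omega>" "Z x' h' x' \<in> \<Omega>" and T: "cbl J T"
    and "\<And>i v. T ((x$i) v) = (x'$i) (T v)" "\<And>i v. T ((h$i) v) = (h'$i) (T v)"
  shows "(ncdiff x' x' h' $ j) (T v) = T ((ncdiff x x h $ j) v)"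
proof -
  define S where "S = (A o\<^sub>L T o\<^sub>L P) + (B o\<^sub>L T o\<^sub>L Q)"
  have "S ((f (Z x h x) $ j) (B v)) = (f (Z x' h' x') $ j) (S (B v))"
  proof (rule intertwining)
    show "cbl J S" using T by (simp add: cbl_iff S_def bl_simps PJ QJ AJ BJ)
  qed (use assms in \<open>simp_all add: S_def Z_apply bl_simps\<close>)
  then have "P (S ((f (Z x h x) $ j) (B v))) = P ((f (Z x' h' x') $ j) (S (B v)))" by simp
  moreover have "S (B v) = B (T v)" "P (S w) = T (P w)" for w
    by (simp_all add: S_def bl_simps)
  ultimately show ?thesis by (simp add: ncdiff_apply)
qed

lemma ncdiff_BH: "Z x h y \<in> \<Omega> \<Longrightarrow> ncdiff x y h \<in> BH J"
  using f_BH[of "Z x h y"] by (simp add: BH_iff ncdiff_apply PJ BJ)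

lemma ncdiff_cscaleT:
  assumes "Z x h y \<in> \<Omega>" "Z x (cscaleT J c h) y \<in> \<Omega>" "x \<in> BH J" "y \<in> BH J"
  shows "ncdiff x y (cscaleT J c h) = cscaleT J c (ncdiff x y h)"
proof -
  \<comment> \<open>A complex scalar is the operator \<open>Re c + Im c J\<close>; it intertwines
    \<open>x\<close> with itself because the entries of \<open>x\<close> commute with
    \<open>J\<close>.\<close>
  have "(ncdiff x y (cscaleT J c h) $ j) v = (Re c *\<^sub>R id_blinfun + Im c *\<^sub>R J) ((ncdiff x y h $ j) v)" for j v
    by (rule ncdiff_natural) (use assms in \<open>auto simp: cbl_iff cscaleT_def bl_simps BH_apply\<close>)
  thus ?thesis by (auto simp: vec_eq_iff blinfun_eq_iff cscaleT_def bl_simps)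
qed

lemma ncdiff_scaleR:
  assumes "Z x h y \<in> \<Omega>" "Z x (c *\<^sub>R h) y \<in> \<Omega>" "x \<in> BH J" "y \<in> BH J"
  shows "ncdiff x y (c *\<^sub>R h) = c *\<^sub>R ncdiff x y h"
  using ncdiff_cscaleT[of x h y "of_real c"] assms by (simp add: cscaleT_of_real)

text \<open>The graph-like operator \<open>B - A\<close> intertwines \<open>x\<close> with the block matrix with diagonal \<open>(y, x)\<close>
  and corner \<open>y - x\<close>.\<close>

lemma ncdiff_difference:
  assumes "x \<in> \<Omega>" "y \<in> \<Omega>" and Z: "Z y (y - x) x \<in> \<Omega>"
  shows "f y - f x = ncdiff y x (y - x)"
proof -
  let ?z = "Z y (y - x) x"
  have "(B - A) ((f x $ j) v) = (f ?z $ j) ((B - A) v)" for j v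
    by (rule intertwining) (use assms in \<open>simp_all add: cbl_iff AJ BJ Z_apply bl_simps\<close>)
  then have "P ((B - A) ((f x $ j) v)) = P ((f ?z $ j) ((B - A) v))" for j v by simp
  \<comment> \<open>The upper left entry of \<open>f ?z\<close> is \<open>f y\<close>. Comparing
    first components in the previous identity then gives
    \<open>- f x = ncdiff y x (y - x) - f y\<close>.\<close>
  moreover have "A ((f y $ j) v) = (f ?z $ j) (A v)" for j v
    by (rule intertwining) (use assms in \<open>simp_all add: cbl_iff AJ Z_apply bl_simps\<close>)
  then have "P (A ((f y $ j) v)) = P ((f ?z $ j) (A v))" for j v by simp
  ultimately show ?thesis
    by (simp add: vec_eq_iff blinfun_eq_iff ncdiff_apply bl_simps)
       (metis (no_types, lifting) add_diff_cancel_left' add_uminus_conv_diff diff_add_cancel diff_minus_eq_add minus_diff_eq)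
qed

end

section \<open>The corner as Frechet derivative\<close>

lemma ex_small_factor:
  fixes a b \<epsilon> :: real
  assumes "\<epsilon> > 0" "0 \<le> a" "0 \<le> b"
  obtains c where "c > 0" "c * a < \<epsilon>" "c * b < \<epsilon>"
proof (rule that[of "\<epsilon> / (a + b + 1)"])
  show "\<epsilon> / (a + b + 1) > 0" "\<epsilon> / (a + b + 1) * a < \<epsilon>" "\<epsilon> / (a + b + 1) * b < \<epsilon>"
    using assms by (simp_all add: field_simps add_pos_nonneg add_nonneg_pos)
qed

context nc_calculus
begin

text \<open>\<open>f\<close> is a total function constrained only on \<open>\<Omega>\<close>; for
  directions of norm below \<open>\<epsilon>\<close> the corner is read from values of
  \<open>f\<close> inside the domain.\<close>

definition admissible :: "real \<Rightarrow> ('h \<Rightarrow>\<^sub>L 'h)^'d \<Rightarrow> ('h \<Rightarrow>\<^sub>L 'h)^'d \<Rightarrow> bool" where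
  "admissible \<epsilon> x y \<longleftrightarrow> \<epsilon> > 0 \<and> x \<in> BH J \<and> y \<in> BH J \<and> (\<forall>h\<in>BH J. tnorm h < \<epsilon> \<longrightarrow> Z x h y \<in> \<Omega>)"

text \<open>The linear extension of \<open>ncdiff x y\<close>, which is only meaningful on a small ball, to all directions.\<close>

definition ncderiv :: "('h \<Rightarrow>\<^sub>L 'h)^'d \<Rightarrow> ('h \<Rightarrow>\<^sub>L 'h)^'d \<Rightarrow> ('h \<Rightarrow>\<^sub>L 'h)^'d \<Rightarrow> ('h \<Rightarrow>\<^sub>L 'h)^'r" where
  "ncderiv x y h = (SOME g. \<exists>\<delta>>0. \<forall>c. 0 < c \<longrightarrow> c < \<delta> \<longrightarrow> ncdiff x y (c *\<^sub>R h) = c *\<^sub>R g)"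

lemma ncderiv_eq:
  assumes r: "admissible \<epsilon> x y" and h: "h \<in> BH J" and c: "0 < c" "c * tnorm h < \<epsilon>"
  shows "ncdiff x y (c *\<^sub>R h) = c *\<^sub>R ncderiv x y h"
proof -
  let ?g = "(1 / c) *\<^sub>R ncdiff x y (c *\<^sub>R h)"
  have \<epsilon>: "\<epsilon> > 0" and xy: "x \<in> BH J" "y \<in> BH J"
    and Z: "\<And>h. h \<in> BH J \<Longrightarrow> tnorm h < \<epsilon> \<Longrightarrow> Z x h y \<in> \<Omega>"
    using r unfolding admissible_def by auto
  have g: "ncdiff x y (b *\<^sub>R h) = b *\<^sub>R ?g" if b: "0 < b" "b * tnorm h < \<epsilon>" for b
  proof -
    have "ncdiff x y ((b / c) *\<^sub>R (c *\<^sub>R h)) = (b / c) *\<^sub>R ncdiff x y (c *\<^sub>R h)"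
      by (rule ncdiff_scaleR) (use b c h xy in \<open>auto intro!: Z BH_scaleR simp: tnorm_scaleR\<close>)
    thus ?thesis using c by simp
  qed
  define \<delta> where "\<delta> = \<epsilon> / (1 + tnorm h)"
  have \<delta>: "\<delta> > 0" using \<epsilon> by (simp add: \<delta>_def add_pos_nonneg)
  have *: "b * tnorm h < \<epsilon>" if "0 < b" "b < \<delta>" for b
  proof -
    have "b * (1 + tnorm h) < \<epsilon>"
      using that by (simp add: \<delta>_def pos_less_divide_eq add_pos_nonneg)
    thus ?thesis using that(1) by (simp add: algebra_simps)
  qed
  have "\<exists>g. \<exists>\<delta>>0. \<forall>c. 0 < c \<longrightarrow> c < \<delta> \<longrightarrow> ncdiff x y (c *\<^sub>R h) = c *\<^sub>R g"
    using \<delta> * g by blast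
  then have "\<exists>\<delta>>0. \<forall>c. 0 < c \<longrightarrow> c < \<delta> \<longrightarrow> ncdiff x y (c *\<^sub>R h) = c *\<^sub>R ncderiv x y h"
    unfolding ncderiv_def by (rule someI_ex)
  then obtain \<delta>' where \<delta>': "\<delta>' > 0" "\<And>c. 0 < c \<Longrightarrow> c < \<delta>' \<Longrightarrow> ncdiff x y (c *\<^sub>R h) = c *\<^sub>R ncderiv x y h"
    by blast
  \<comment> \<open>The choice operator guarantees its equation only below an unknown radius
    \<open>\<delta>'\<close>. At a scale below both radii the two expressions can be compared, and
    \<open>b\<close> cancels.\<close>
  define b where "b = min \<delta> \<delta>' / 2"
  have b: "0 < b" "b < \<delta>" "b < \<delta>'" using \<delta> \<delta>'(1) by (auto simp: b_def)
  then have "b *\<^sub>R ?g = b *\<^sub>R ncderiv x y h"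
    using g[of b] *[of b] \<delta>'(2)[of b] by metis
  then have "?g = ncderiv x y h" using b(1) unfolding scaleR_cancel_left by simp
  then show ?thesis using g[OF c] by metis
qed

lemma ncderiv_eq_ncdiff: "admissible \<epsilon> x y \<Longrightarrow> h \<in> BH J \<Longrightarrow> tnorm h < \<epsilon> \<Longrightarrow> ncdiff x y h = ncderiv x y h"
  using ncderiv_eq[of \<epsilon> x y h 1] by simp

lemma admissible_block: "admissible \<epsilon> x y \<Longrightarrow> h \<in> BH J \<Longrightarrow> \<bar>c\<bar> * tnorm h < \<epsilon> \<Longrightarrow> Z x (c *\<^sub>R h) y \<in> \<Omega>"
  unfolding admissible_def by (simp add: BH_scaleR tnorm_scaleR)

lemma ncderiv_natural:
  assumes r: "admissible \<epsilon> x y" "admissible \<epsilon> x' y" and h: "h \<in> BH J" "h' \<in> BH J" and T: "cbl J T"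
    and "\<And>i v. T ((x$i) v) = (x'$i) (T v)" and Th: "\<And>i v. T ((h$i) v) = (h'$i) v"
  shows "(ncderiv x' y h' $ j) v = T ((ncderiv x y h $ j) v)"
proof -
  have "\<epsilon> > 0" using r unfolding admissible_def by simp
  then obtain c where c: "c > 0" "c * tnorm h < \<epsilon>" "c * tnorm h' < \<epsilon>"
    by (rule ex_small_factor[OF _ tnorm_nonneg tnorm_nonneg])
  have "(ncdiff x' y (c *\<^sub>R h') $ j) v = T ((ncdiff x y (c *\<^sub>R h) $ j) v)"
    by (rule ncdiff_natural) (use assms c in \<open>auto intro!: admissible_block simp: bl_simps admissible_def\<close>)
  then have "c *\<^sub>R (ncderiv x' y h' $ j) v = c *\<^sub>R T ((ncderiv x y h $ j) v)"
    using ncderiv_eq[OF r(1) h(1) c(1,2)] ncderiv_eq[OF r(2) h(2) c(1,3)] by (simp add: bl_simps)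
  thus ?thesis using c(1) by simp
qed

lemma ncderiv_cscaleT:
  assumes r: "admissible \<epsilon> x y" and h: "h \<in> BH J"
  shows "ncderiv x y (cscaleT J z h) = cscaleT J z (ncderiv x y h)"
proof -
  have "(ncderiv x y (cscaleT J z h) $ j) v = (Re z *\<^sub>R id_blinfun + Im z *\<^sub>R J) ((ncderiv x y h $ j) v)" for j v
    by (rule ncderiv_natural[OF r r])
       (use assms in \<open>auto simp: admissible_def cbl_iff cscaleT_def bl_simps BH_apply BH_cscaleT[unfolded cscaleT_def]\<close>)
  thus ?thesis by (auto simp: vec_eq_iff blinfun_eq_iff cscaleT_def bl_simps)
qed

lemma ncderiv_scaleR: "admissible \<epsilon> x y \<Longrightarrow> h \<in> BH J \<Longrightarrow> ncderiv x y (c *\<^sub>R h) = c *\<^sub>R ncderiv x y h"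
  using ncderiv_cscaleT[of \<epsilon> x y h "of_real c"] by (simp add: cscaleT_of_real)

lemma ncderiv_BH:
  assumes r: "admissible \<epsilon> x y" and h: "h \<in> BH J"
  shows "ncderiv x y h \<in> BH J"
proof -
  have "\<epsilon> > 0" using r unfolding admissible_def by simp
  then obtain c where c: "c > 0" "c * tnorm h < \<epsilon>"
    by (metis ex_small_factor tnorm_nonneg)
  have "ncdiff x y (c *\<^sub>R h) \<in> BH J" by (rule ncdiff_BH, rule admissible_block) (use r h c in auto)
  then have "(1 / c) *\<^sub>R (c *\<^sub>R ncderiv x y h) \<in> BH J"
    unfolding ncderiv_eq[OF r h c] by (rule BH_scaleR)
  thus ?thesis using c by simp
qed

text \<open>Additivity comes from compressing the direction with entries \<open>h\<close>, \<open>k\<close> at the point \<open>x \<oplus> x\<close>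
  to either entry, and to their sum.\<close>

lemma ncderiv_add:
  assumes r: "admissible \<epsilon> x y" and r1: "admissible \<epsilon> (Z x 0 x) y" and h: "h \<in> BH J" and k: "k \<in> BH J"
  shows "ncderiv x y (h + k) = ncderiv x y h + ncderiv x y k"
proof -
  define g where "g = (\<chi> i. (A o\<^sub>L h$i) + (B o\<^sub>L k$i))"
  have g: "g \<in> BH J" using h k by (simp add: g_def BH_iff bl_simps AJ BJ)
  have "(ncderiv x y h $ j) v = P ((ncderiv (Z x 0 x) y g $ j) v)" for j v
    by (rule ncderiv_natural[OF r1 r g h]) (auto simp: cbl_iff PJ Z_apply g_def bl_simps)
  moreover have "(ncderiv x y k $ j) v = Q ((ncderiv (Z x 0 x) y g $ j) v)" for j v
    by (rule ncderiv_natural[OF r1 r g k]) (auto simp: cbl_iff QJ Z_apply g_def bl_simps)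
  \<comment> \<open>\<open>P + Q\<close> is an intertwiner because both diagonal entries of
    \<open>Z x 0 x\<close> equal \<open>x\<close>.\<close>
  moreover have "(ncderiv x y (h + k) $ j) v = (P + Q) ((ncderiv (Z x 0 x) y g $ j) v)" for j v
    by (rule ncderiv_natural[OF r1 r g BH_add[OF h k]]) (auto simp: cbl_iff PJ QJ Z_apply g_def bl_simps)
  ultimately show ?thesis by (simp add: vec_eq_iff blinfun_eq_iff bl_simps)
qed

lemma admissible_\<Omega>k: obtains \<epsilon> where "\<epsilon> > 0" "\<And>x y. x \<in> \<Omega>k k \<Longrightarrow> y \<in> \<Omega>k k \<Longrightarrow> admissible \<epsilon> x y"
  "\<And>x y h. x \<in> \<Omega>k k \<Longrightarrow> y \<in> \<Omega>k k \<Longrightarrow> h \<in> BH J \<Longrightarrow> tnorm h < \<epsilon> \<Longrightarrow> Z x h y \<in> \<Omega>k (Suc k)"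
  "\<And>x h. x \<in> \<Omega>k k \<Longrightarrow> h \<in> BH J \<Longrightarrow> tnorm h < \<epsilon> \<Longrightarrow> x + h \<in> \<Omega>k (Suc k)"
proof -
  obtain \<epsilon> where e: "\<epsilon> > 0"
    "\<And>x y h. x \<in> \<Omega>k k \<Longrightarrow> y \<in> \<Omega>k k \<Longrightarrow> h \<in> BH J \<Longrightarrow> tnorm h < \<epsilon> \<Longrightarrow> Z x h y \<in> \<Omega>k (Suc k)"
    "\<And>x h. x \<in> \<Omega>k k \<Longrightarrow> h \<in> BH J \<Longrightarrow> tnorm h < \<epsilon> \<Longrightarrow> x + h \<in> \<Omega>k (Suc k)"
    by (rule eps_Z[of k]) blast
  have "admissible \<epsilon> x y" if "x \<in> \<Omega>k k" "y \<in> \<Omega>k k" for x y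
    unfolding admissible_def using e(1) e(2)[OF that] that \<Omega>k_BH \<Omega>k_\<Omega> by blast
  thus thesis using that e by blast
qed

lemma ncderiv_0: "admissible \<epsilon> x y \<Longrightarrow> ncderiv x y 0 = 0"
  using ncderiv_scaleR[of \<epsilon> x y 0 0] by (simp add: BH_zero)

text \<open>A Cauchy-type estimate: scale the direction to norm \<open>\<epsilon> / 2\<close>, where
  the corner is a compression of a value of \<open>f\<close> on \<open>\<Omega>k (Suc k)\<close> and
  so is at most \<open>M\<close>. Scaling back gives \<open>2 * M / \<epsilon>\<close>.\<close>

lemma ncderiv_bound:
  obtains K where "K > 0"
    "\<And>x y h. x \<in> \<Omega>k k \<Longrightarrow> y \<in> \<Omega>k k \<Longrightarrow> h \<in> BH J \<Longrightarrow> tnorm (ncderiv x y h) \<le> K * tnorm h"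
proof -
  obtain \<epsilon> where \<epsilon>: "\<epsilon> > 0" and r: "\<And>x y. x \<in> \<Omega>k k \<Longrightarrow> y \<in> \<Omega>k k \<Longrightarrow> admissible \<epsilon> x y"
    and Z: "\<And>x y h. x \<in> \<Omega>k k \<Longrightarrow> y \<in> \<Omega>k k \<Longrightarrow> h \<in> BH J \<Longrightarrow> tnorm h < \<epsilon> \<Longrightarrow> Z x h y \<in> \<Omega>k (Suc k)"
    by (rule admissible_\<Omega>k[of k]) blast
  obtain M where M: "M > 0" "\<And>x. x \<in> \<Omega>k (Suc k) \<Longrightarrow> tnorm (f x) \<le> M"
    by (rule f_bounded[of "Suc k"]) blast
  show thesis
  proof (rule that[of "2 * M / \<epsilon>"])
    fix x y h :: "('h \<Rightarrow>\<^sub>L 'h)^'d" assume *: "x \<in> \<Omega>k k" "y \<in> \<Omega>k k" "h \<in> BH J"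
    note rr = r[OF *(1,2)]
    show "tnorm (ncderiv x y h) \<le> 2 * M / \<epsilon> * tnorm h"
    proof (cases "h = 0")
      case True thus ?thesis using ncderiv_0[OF rr] by simp
    next
      case False
      then have t: "tnorm h > 0" using tnorm_eq_0_iff[of h] tnorm_nonneg[of h] by linarith
      define c where "c = \<epsilon> / (2 * tnorm h)"
      have c: "c > 0" "c * tnorm h = \<epsilon> / 2" using t \<epsilon> by (auto simp: c_def)
      then have c2: "c * tnorm h < \<epsilon>" using \<epsilon> by simp
      have "tnorm (f (Z x (c *\<^sub>R h) y)) \<le> M"
        by (intro M(2) Z *(1,2) BH_scaleR *(3)) (use c(1) c2 in \<open>simp add: tnorm_scaleR\<close>)
      then have "tnorm (ncdiff x y (c *\<^sub>R h)) \<le> M"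
        unfolding ncdiff_def using tnorm_PhB order_trans by blast
      then have "c * tnorm (ncderiv x y h) \<le> M"
        using ncderiv_eq[OF rr *(3) c(1) c2] c(1) by (simp add: tnorm_scaleR)
      thus ?thesis using \<epsilon> t by (simp add: c_def field_simps)
    qed
  qed (use M \<epsilon> in auto)
qed

lemma difference_eq_ncderiv:
  assumes "admissible \<epsilon> y x" "x \<in> \<Omega>" "y \<in> \<Omega>" "tnorm (y - x) < \<epsilon>"
  shows "f y - f x = ncderiv y x (y - x)"
proof -
  have d: "y - x \<in> BH J" using assms \<Omega>_BH BH_diff by blast
  have "Z y (y - x) x \<in> \<Omega>" using assms(1,4) d unfolding admissible_def by blast
  thus ?thesis using ncdiff_difference assms ncderiv_eq_ncdiff[OF assms(1) d assms(4)] by simp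
qed

text \<open>The exact formula \<open>f y - f x = ncderiv y x (y - x)\<close>, with two different
  base points, replaces the mean value theorem.\<close>

lemma f_lipschitz:
  obtains K \<epsilon> where "K > 0" "\<epsilon> > 0"
    "\<And>x y. x \<in> \<Omega>k k \<Longrightarrow> y \<in> \<Omega>k k \<Longrightarrow> tnorm (y - x) < \<epsilon> \<Longrightarrow> tnorm (f y - f x) \<le> K * tnorm (y - x)"
proof -
  obtain \<epsilon> where \<epsilon>: "\<epsilon> > 0" and r: "\<And>x y. x \<in> \<Omega>k k \<Longrightarrow> y \<in> \<Omega>k k \<Longrightarrow> admissible \<epsilon> x y"
    by (rule admissible_\<Omega>k[of k]) blast
  obtain K where K: "K > 0"
    "\<And>x y h. x \<in> \<Omega>k k \<Longrightarrow> y \<in> \<Omega>k k \<Longrightarrow> h \<in> BH J \<Longrightarrow> tnorm (ncderiv x y h) \<le> K * tnorm h"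
    by (rule ncderiv_bound[of k]) blast
  show thesis
  proof (rule that[OF K(1) \<epsilon>])
    fix x y assume *: "x \<in> \<Omega>k k" "y \<in> \<Omega>k k" "tnorm (y - x) < \<epsilon>"
    show "tnorm (f y - f x) \<le> K * tnorm (y - x)"
      using difference_eq_ncderiv[OF r[OF *(2,1)] \<Omega>k_\<Omega>[OF *(1)] \<Omega>k_\<Omega>[OF *(2)] *(3)]
        K(2)[OF *(2,1) BH_diff[OF \<Omega>k_BH[OF *(2)] \<Omega>k_BH[OF *(1)]]] by simp
  qed
qed

text \<open>Changing the first base point alters only the upper left entry of the block point, by
  \<open>y - x\<close>. The Lipschitz bound for \<open>f\<close> one level higher applies, again
  after scaling the direction to norm \<open>\<epsilon> / 2\<close>.\<close>

lemma ncderiv_lipschitz: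
  obtains K \<epsilon> where "K > 0" "\<epsilon> > 0"
    "\<And>x y h. x \<in> \<Omega>k k \<Longrightarrow> y \<in> \<Omega>k k \<Longrightarrow> h \<in> BH J \<Longrightarrow> tnorm (y - x) < \<epsilon> \<Longrightarrow>
       tnorm (ncderiv y x h - ncderiv x x h) \<le> K * tnorm (y - x) * tnorm h"
proof -
  obtain \<epsilon> where \<epsilon>: "\<epsilon> > 0" and r: "\<And>x y. x \<in> \<Omega>k k \<Longrightarrow> y \<in> \<Omega>k k \<Longrightarrow> admissible \<epsilon> x y"
    and Z: "\<And>x y h. x \<in> \<Omega>k k \<Longrightarrow> y \<in> \<Omega>k k \<Longrightarrow> h \<in> BH J \<Longrightarrow> tnorm h < \<epsilon> \<Longrightarrow> Z x h y \<in> \<Omega>k (Suc k)"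
    by (rule admissible_\<Omega>k[of k]) blast
  obtain K e where K: "K > 0" and e: "e > 0" and lip:
    "\<And>x y. x \<in> \<Omega>k (Suc k) \<Longrightarrow> y \<in> \<Omega>k (Suc k) \<Longrightarrow> tnorm (y - x) < e \<Longrightarrow> tnorm (f y - f x) \<le> K * tnorm (y - x)"
    by (rule f_lipschitz[of "Suc k"]) blast
  show thesis
  proof (rule that[of "2 * K / \<epsilon>" e])
    fix x y h :: "('h \<Rightarrow>\<^sub>L 'h)^'d"
    assume *: "x \<in> \<Omega>k k" "y \<in> \<Omega>k k" "h \<in> BH J" and xy: "tnorm (y - x) < e"
    note r1 = r[OF *(2,1)] and r2 = r[OF *(1,1)]
    show "tnorm (ncderiv y x h - ncderiv x x h) \<le> 2 * K / \<epsilon> * tnorm (y - x) * tnorm h"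
    proof (cases "h = 0")
      case True thus ?thesis using ncderiv_0[OF r1] ncderiv_0[OF r2] by simp
    next
      case False
      then have t: "tnorm h > 0" using tnorm_eq_0_iff[of h] tnorm_nonneg[of h] by linarith
      define c where "c = \<epsilon> / (2 * tnorm h)"
      have c: "c > 0" "c * tnorm h = \<epsilon> / 2" using t \<epsilon> by (auto simp: c_def)
      then have c2: "c * tnorm h < \<epsilon>" using \<epsilon> by simp
      let ?Y = "Z y (c *\<^sub>R h) x" and ?X = "Z x (c *\<^sub>R h) x"
      have ch: "c *\<^sub>R h \<in> BH J" "tnorm (c *\<^sub>R h) < \<epsilon>"
        using *(3) c(1) c2 by (auto intro: BH_scaleR simp: tnorm_scaleR)
      have "?Y - ?X = (\<chi> i. A o\<^sub>L (y - x)$i o\<^sub>L P)"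
        by (auto simp: vec_eq_iff blinfun_eq_iff Z_apply bl_simps)
      then have YX: "tnorm (?Y - ?X) \<le> tnorm (y - x)" using tnorm_AhP[of "y - x"] by simp
      have "tnorm (f ?Y - f ?X) \<le> K * tnorm (?Y - ?X)"
        by (rule lip) (use Z *(1,2) ch YX xy in auto)
      also have "\<dots> \<le> K * tnorm (y - x)" using YX K by simp
      finally have 1: "tnorm (f ?Y - f ?X) \<le> K * tnorm (y - x)" .
      have "ncdiff y x (c *\<^sub>R h) - ncdiff x x (c *\<^sub>R h) = (\<chi> j. P o\<^sub>L (f ?Y - f ?X) $ j o\<^sub>L B)"
        by (auto simp: vec_eq_iff blinfun_eq_iff ncdiff_apply bl_simps)
      then have "tnorm (ncdiff y x (c *\<^sub>R h) - ncdiff x x (c *\<^sub>R h)) \<le> K * tnorm (y - x)"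
        using 1 tnorm_PhB[of "f ?Y - f ?X"] by simp
      moreover have "ncdiff y x (c *\<^sub>R h) - ncdiff x x (c *\<^sub>R h) = c *\<^sub>R (ncderiv y x h - ncderiv x x h)"
        using ncderiv_eq[OF r1 *(3) c(1) c2] ncderiv_eq[OF r2 *(3) c(1) c2] by (simp add: scaleR_diff_right)
      ultimately have "c * tnorm (ncderiv y x h - ncderiv x x h) \<le> K * tnorm (y - x)"
        using c(1) by (simp add: tnorm_scaleR)
      thus ?thesis using \<epsilon> t by (simp add: c_def field_simps)
    qed
  qed (use K \<epsilon> e in auto)
qed

text \<open>The increment is exactly \<open>ncderiv (x + h) x h\<close>; replacing the first base
  point by \<open>x\<close> costs an error quadratic in \<open>h\<close>.\<close>

theorem has_fderiv_ncderiv: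
  assumes "x \<in> \<Omega>"
  shows "has_fderiv J \<Omega> f x (ncderiv x x)"
proof -
  obtain k where x: "x \<in> \<Omega>k k" using assms \<Omega>_eq by auto
  have x1: "x \<in> \<Omega>k (Suc k)" using x by (rule \<Omega>k_Suc)
  obtain \<epsilon> where \<epsilon>: "\<epsilon> > 0" and r: "\<And>x y. x \<in> \<Omega>k k \<Longrightarrow> y \<in> \<Omega>k k \<Longrightarrow> admissible \<epsilon> x y"
    and xh: "\<And>h. h \<in> BH J \<Longrightarrow> tnorm h < \<epsilon> \<Longrightarrow> x + h \<in> \<Omega>k (Suc k)"
    by (rule admissible_\<Omega>k[of k]) (use x in blast)
  obtain e1 where e1: "e1 > 0" and r1: "\<And>x y. x \<in> \<Omega>k (Suc k) \<Longrightarrow> y \<in> \<Omega>k (Suc k) \<Longrightarrow> admissible e1 x y"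
    by (rule admissible_\<Omega>k[of "Suc k"]) blast
  obtain K0 where K0:
    "\<And>x y h. x \<in> \<Omega>k k \<Longrightarrow> y \<in> \<Omega>k k \<Longrightarrow> h \<in> BH J \<Longrightarrow> tnorm (ncderiv x y h) \<le> K0 * tnorm h"
    by (rule ncderiv_bound[of k]) blast
  obtain K e2 where K: "K > 0" and e2: "e2 > 0" and lip:
    "\<And>x y h. x \<in> \<Omega>k (Suc k) \<Longrightarrow> y \<in> \<Omega>k (Suc k) \<Longrightarrow> h \<in> BH J \<Longrightarrow> tnorm (y - x) < e2 \<Longrightarrow>
       tnorm (ncderiv y x h - ncderiv x x h) \<le> K * tnorm (y - x) * tnorm h"
    by (rule ncderiv_lipschitz[of "Suc k"]) blast
  note rx = r[OF x x] and rx' = r[OF Z_diag[OF x x] x]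
  show ?thesis
    unfolding has_fderiv_def
  proof (intro conjI allI impI ballI)
    show "ncderiv x x h \<in> BH J" if "h \<in> BH J" for h by (rule ncderiv_BH[OF rx that])
    show "ncderiv x x (h + k) = ncderiv x x h + ncderiv x x k" if "h \<in> BH J" "k \<in> BH J" for h k
      by (rule ncderiv_add[OF rx rx' that])
    show "ncderiv x x (cscaleT J c h) = cscaleT J c (ncderiv x x h)" if "h \<in> BH J" for c h
      by (rule ncderiv_cscaleT[OF rx that])
    show "\<exists>K. \<forall>h\<in>BH J. tnorm (ncderiv x x h) \<le> K * tnorm h" using K0[OF x x] by blast
    fix e :: real assume e: "e > 0"
    \<comment> \<open>\<open>\<epsilon>\<close> keeps \<open>x + h\<close> in
      \<open>\<Omega>k (Suc k)\<close>, \<open>e1\<close> makes the increment formula valid there,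
      \<open>e2\<close> makes the Lipschitz bound valid, and \<open>e / K\<close> turns the
      quadratic error into \<open>e * tnorm h\<close>.\<close>
    define \<delta> where "\<delta> = min (min \<epsilon> e1) (min e2 (e / K))"
    show "\<exists>\<delta>>0. \<forall>h\<in>BH J. tnorm h < \<delta> \<and> x + h \<in> \<Omega> \<longrightarrow> tnorm (f (x + h) - f x - ncderiv x x h) \<le> e * tnorm h"
    proof (intro exI[of _ \<delta>] conjI ballI impI)
      show "\<delta> > 0" using \<epsilon> e1 e2 e K by (simp add: \<delta>_def)
      fix h assume h: "h \<in> BH J" and "tnorm h < \<delta> \<and> x + h \<in> \<Omega>"
      then have hd: "tnorm h < \<epsilon>" "tnorm h < e1" "tnorm h < e2" "tnorm h < e / K" and xo: "x + h \<in> \<Omega>"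
        by (auto simp: \<delta>_def)
      have y: "x + h \<in> \<Omega>k (Suc k)" using xh[OF h hd(1)] .
      have "f (x + h) - f x = ncderiv (x + h) x h"
        using difference_eq_ncderiv[OF r1[OF y x1] assms xo] hd(2) by simp
      then have "tnorm (f (x + h) - f x - ncderiv x x h) \<le> K * tnorm h * tnorm h"
        using lip[OF x1 y h] hd(3) by simp
      also have "\<dots> \<le> e * tnorm h"
        using hd(4) K by (intro mult_right_mono) (auto simp: field_simps)
      finally show "tnorm (f (x + h) - f x - ncderiv x x h) \<le> e * tnorm h" .
    qed
  qed
qed

end

text \<open>Links an arbitrary \<open>L\<close>, as it occurs in the theorem, to the corner. The
  comparison is confined to \<open>BH J\<close>, since \<open>has_fderiv\<close> does not constrain
  \<open>L\<close> elsewhere, and takes place along \<open>t *\<^sub>R h\<close> inside a ball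
  around \<open>x\<close>.\<close>

lemma has_fderiv_unique:
  assumes L: "has_fderiv J \<Omega> f x L" and L': "has_fderiv J \<Omega> f x L'"
    and int: "e > 0" "\<And>h. h \<in> BH J \<Longrightarrow> tnorm h < e \<Longrightarrow> x + h \<in> \<Omega>" and h: "h \<in> BH J"
  shows "L h = L' h"
proof -
  have lin: "L (t *\<^sub>R h) = t *\<^sub>R L h" "L' (t *\<^sub>R h) = t *\<^sub>R L' h" for t
    using L L' h unfolding has_fderiv_def by (metis cscaleT_of_real)+
  have le: "tnorm (L h - L' h) \<le> a" if a: "a > 0" for a
  proof -
    define b where "b = a / (2 * (tnorm h + 1))"
    have b: "b > 0" using a by (simp add: b_def add_nonneg_pos)
    obtain d where d: "d > 0" "\<And>h. h \<in> BH J \<Longrightarrow> tnorm h < d \<and> x + h \<in> \<Omega> \<Longrightarrow> tnorm (f (x + h) - f x - L h) \<le> b * tnorm h"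
      using L b unfolding has_fderiv_def by blast
    obtain d' where d': "d' > 0" "\<And>h. h \<in> BH J \<Longrightarrow> tnorm h < d' \<and> x + h \<in> \<Omega> \<Longrightarrow> tnorm (f (x + h) - f x - L' h) \<le> b * tnorm h"
      using L' b unfolding has_fderiv_def by blast
    obtain t where t: "t > 0" "t * tnorm h < min e (min d d')"
      using ex_small_factor[of "min e (min d d')" "tnorm h" 0] int(1) d(1) d'(1) by auto
    have th: "t *\<^sub>R h \<in> BH J" "tnorm (t *\<^sub>R h) < min e (min d d')"
      using h t by (auto intro: BH_scaleR simp: tnorm_scaleR)
    have "t *\<^sub>R (L h - L' h) =
        (f (x + t *\<^sub>R h) - f x - L' (t *\<^sub>R h)) - (f (x + t *\<^sub>R h) - f x - L (t *\<^sub>R h))"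
      by (simp add: lin scaleR_diff_right)
    then have "tnorm (t *\<^sub>R (L h - L' h)) \<le>
        tnorm (f (x + t *\<^sub>R h) - f x - L' (t *\<^sub>R h)) + tnorm (f (x + t *\<^sub>R h) - f x - L (t *\<^sub>R h))"
      using tnorm_diff_triangle by metis
    also have "\<dots> \<le> b * tnorm (t *\<^sub>R h) + b * tnorm (t *\<^sub>R h)"
      using d(2)[OF th(1)] d'(2)[OF th(1)] int(2)[OF th(1)] th(2) by (intro add_mono) auto
    finally have "t * tnorm (L h - L' h) \<le> t * (2 * b * tnorm h)"
      using t(1) unfolding tnorm_scaleR by (simp add: algebra_simps)
    then have "tnorm (L h - L' h) \<le> 2 * b * tnorm h" using t(1) by simp
    also have "\<dots> = a * (tnorm h / (tnorm h + 1))" using tnorm_nonneg[of h] by (simp add: b_def divide_simps)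
    also have "\<dots> \<le> a * 1" using a by (intro mult_left_mono) (simp_all add: divide_le_eq_1 add_nonneg_pos)
    also have "\<dots> = a" by simp
    finally show ?thesis .
  qed
  have "tnorm (L h - L' h) \<le> 0" by (rule field_le_epsilon) (simp add: le)
  then have "tnorm (L h - L' h) = 0" using tnorm_nonneg antisym by blast
  thus ?thesis by (simp add: tnorm_eq_0_iff)
qed

subsection \<open>Strong compactness up to unitary equivalence\<close>

lemma cunitary_id: "cunitary J id_blinfun id_blinfun"
  by (simp add: cunitary_def cbl_iff blinfun_eq_iff)

lemma cunitary_compose:
  assumes "cunitary J u w" "cunitary J u' w'"
  shows "cunitary J (u' o\<^sub>L u) (w o\<^sub>L w')"
  using assms by (simp add: cunitary_def cbl_iff blinfun_eq_iff)

lemma cunitary_inverse: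
  assumes "cunitary J u w"
  shows "w (u v) = v" "u (w v) = v"
  using assms by (simp_all add: cunitary_def blinfun_eq_iff)

lemma cunitary_sym:
  assumes "cunitary J u w"
  shows "cunitary J w u"
proof -
  note i = cunitary_inverse[OF assms]
  have "w (J v) = J (w v)" for v
    using assms i unfolding cunitary_def cbl_iff by metis
  moreover have "norm (w v) = norm v" for v
    using assms i unfolding cunitary_def by metis
  ultimately show ?thesis
    by (simp add: cunitary_def cbl_iff blinfun_eq_iff i)
qed

lemma norm_conj_le:
  assumes "cunitary J u w"
  shows "norm (u o\<^sub>L T o\<^sub>L w) \<le> norm T"
proof (rule norm_blinfun_bound)
  fix v
  have "norm ((u o\<^sub>L T o\<^sub>L w) v) = norm (T (w v))" "norm (w v) = norm v"
    using assms cunitary_sym[OF assms] by (simp_all add: cunitary_def)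
  thus "norm ((u o\<^sub>L T o\<^sub>L w) v) \<le> norm T * norm v"
    using norm_blinfun[of T "w v"] by simp
qed auto

section \<open>Complex subspaces and unitaries moving vectors into them\<close>

locale complex_structure =
  fixes J :: "'h::{real_inner,complete_space} \<Rightarrow>\<^sub>L 'h"
  assumes JJ [simp]: "J (J v) = - v"
    and JO [simp]: "inner (J v) (J w) = inner v w"
begin

lemma J_left: "inner (J v) w = - inner v (J w)"
  using JO[of "J v" w] by simp

lemma norm_J [simp]: "norm (J v) = norm v"
  by (simp add: norm_eq_sqrt_inner)

lemma inner_J_self [simp]: "inner v (J v) = 0" "inner (J v) v = 0"
  using J_left[of v v] by (simp_all add: inner_commute)

lemma norm_complex_combination:
  "(norm (s *\<^sub>R v + t *\<^sub>R J v))\<^sup>2 = (s\<^sup>2 + t\<^sup>2) * (norm v)\<^sup>2"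
  unfolding power2_norm_eq_inner by (simp add: inner_simps algebra_simps power2_eq_square)

text \<open>The reflection \<open>v \<mapsto> v - 2 \<langle>v, c\<rangle> c\<close> in the complex hyperplane orthogonal to \<open>c = a - b\<close>;
  it swaps \<open>a\<close> and \<open>b\<close> only if their complex inner product is real.\<close>

lemma reflection:
  assumes a: "norm a = 1" and b: "norm b = 1" and real: "inner a (J b) = 0"
  obtains u where "cunitary J u u" "u a = b"
    "\<And>v. inner v (a - b) = 0 \<Longrightarrow> inner v (J (a - b)) = 0 \<Longrightarrow> u v = v"
proof (cases "a = b")
  case True
  show thesis by (rule that[of id_blinfun]) (simp_all add: cunitary_id True)
next
  case False
  define n where "n = norm (a - b)"
  define c where "c = (1 / n) *\<^sub>R (a - b)"
  have n: "n > 0" using False by (simp add: n_def)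
  have cc: "inner c c = 1"
    using n by (simp add: c_def n_def inner_simps power2_norm_eq_inner[symmetric] power2_eq_square[symmetric])
  have J_c [simp]: "inner (J c) c = 0" "inner c (J c) = 0" by simp_all
  \<comment> \<open>The complex inner product of \<open>v\<close> and \<open>c\<close> has real part
    \<open>inner v c\<close> and imaginary part \<open>inner v (J c)\<close>.\<close>
  define R where "R = (\<lambda>v. v - (2 * inner v c) *\<^sub>R c - (2 * inner v (J c)) *\<^sub>R J c)"
  have "bounded_linear R"
    unfolding R_def
    by (intro bounded_linear_sub bounded_linear_ident bounded_linear_scaleR_const
        bounded_linear_const_mult bounded_linear_inner_left)
  then have R: "blinfun_apply (Blinfun R) = R" by (rule bounded_linear_Blinfun_apply)
  have RR: "R (R v) = v" for v
    by (simp add: R_def inner_simps cc algebra_simps)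
  have nR: "norm (R v) = norm v" for v
  proof -
    have "inner (R v) (R v) = inner v v"
      by (simp add: R_def inner_simps cc algebra_simps inner_commute)
    thus ?thesis by (simp add: norm_eq_sqrt_inner)
  qed
  have RJ: "R (J v) = J (R v)" for v
    by (simp add: R_def bl_simps J_left)
  have fixed: "R v = v" if "inner v (a - b) = 0" "inner v (J (a - b)) = 0" for v
    using that by (simp add: R_def c_def bl_simps)
  have "R a = b"
  proof -
    have aa: "inner a a = 1" "inner b b = 1"
      using a b by (simp_all add: norm_eq_1)
    have nn: "n * n = 2 - 2 * inner a b"
      by (simp add: n_def power2_eq_square[symmetric] power2_norm_eq_inner inner_simps aa inner_commute)
    have "inner a (J c) = 0"
      by (simp add: c_def bl_simps inner_simps real)
    moreover have "2 * inner a c = n"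
      using n nn by (simp add: c_def inner_simps aa field_simps)
    ultimately have "R a = a - n *\<^sub>R c" by (simp add: R_def)
    thus ?thesis using n by (simp add: c_def)
  qed
  moreover have "cunitary J (Blinfun R) (Blinfun R)"
    by (simp add: cunitary_def cbl_iff blinfun_eq_iff R RR nR RJ)
  ultimately show thesis using that[of "Blinfun R"] fixed by (simp add: R)
qed

text \<open>Finite-dimensional complex subspaces; the orthogonal projections and the compactness of balls are
  carried along because they are inherited when one dimension is adjoined.\<close>

definition flag :: "'h set \<Rightarrow> bool" where
  "flag F \<longleftrightarrow> subspace F \<and> (\<forall>v\<in>F. J v \<in> F) \<and> (\<exists>B. finite B \<and> F \<subseteq> span B) \<and>
    (\<forall>w. \<exists>p\<in>F. \<forall>v\<in>F. inner (w - p) v = 0) \<and> (\<forall>r. compact (F \<inter> cball 0 r))"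

definition adjoin :: "'h set \<Rightarrow> 'h \<Rightarrow> 'h set" where
  "adjoin F a = {p + s *\<^sub>R a + t *\<^sub>R J a | p s t. p \<in> F}"

lemma flag_0: "flag {0}"
  unfolding flag_def
proof (intro conjI allI)
  show "\<exists>B. finite B \<and> {0} \<subseteq> span B" by (intro exI[of _ "{}"]) simp
  show "compact ({0} \<inter> cball 0 r)" for r :: real
    by (rule compact_Int_closed) auto
qed auto

lemma adjoin_superset: "F \<subseteq> adjoin F a"
proof
  fix p assume "p \<in> F"
  then show "p \<in> adjoin F a"
    unfolding adjoin_def by (intro CollectI exI[of _ p] exI[of _ 0]) simp
qed

lemma adjoin_I: "p \<in> F \<Longrightarrow> p + s *\<^sub>R a + t *\<^sub>R J a \<in> adjoin F a"
  unfolding adjoin_def by blast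

lemma J_orthogonal:
  assumes "flag F" "\<And>v. v \<in> F \<Longrightarrow> inner a v = 0" "v \<in> F"
  shows "inner (J a) v = 0"
  using assms unfolding flag_def by (simp add: J_left)

lemma flag_adjoin:
  assumes F: "flag F" and a: "norm a = 1" and orth: "\<And>v. v \<in> F \<Longrightarrow> inner a v = 0"
  shows "flag (adjoin F a)"
proof -
  have sub: "subspace F" and JF: "\<And>v. v \<in> F \<Longrightarrow> J v \<in> F" using F by (auto simp: flag_def)
  have aa: "inner a a = 1" using a by (simp add: norm_eq_1)
  have orthJ: "inner (J a) v = 0" if "v \<in> F" for v
    using J_orthogonal[OF F orth that] .
  have orth': "inner v a = 0" "inner v (J a) = 0" if "v \<in> F" for v
    using orth[OF that] orthJ[OF that] by (simp_all add: inner_commute)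
  show ?thesis
    unfolding flag_def
  proof (intro conjI allI ballI)
    show "subspace (adjoin F a)"
      unfolding subspace_def
    proof (intro conjI ballI allI)
      show "0 \<in> adjoin F a" using adjoin_superset subspace_0[OF sub] by blast
      fix x y assume "x \<in> adjoin F a" "y \<in> adjoin F a"
      then obtain p s t p' s' t' where "p \<in> F" "p' \<in> F"
        "x = p + s *\<^sub>R a + t *\<^sub>R J a" "y = p' + s' *\<^sub>R a + t' *\<^sub>R J a"
        unfolding adjoin_def by blast
      then show "x + y \<in> adjoin F a"
        using adjoin_I[OF subspace_add[OF sub, of p p'], of "s + s'" a "t + t'"] by (simp add: algebra_simps)
    next
      fix c x assume "x \<in> adjoin F a"
      then obtain p s t where "p \<in> F" "x = p + s *\<^sub>R a + t *\<^sub>R J a"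
        unfolding adjoin_def by blast
      then show "c *\<^sub>R x \<in> adjoin F a"
        using adjoin_I[OF subspace_scale[OF sub, of p c], of "c * s" a "c * t"] by (simp add: algebra_simps)
    qed
    show "J x \<in> adjoin F a" if "x \<in> adjoin F a" for x
    proof -
      from that obtain p s t where "p \<in> F" "x = p + s *\<^sub>R a + t *\<^sub>R J a"
        unfolding adjoin_def by blast
      then show ?thesis
        using adjoin_I[OF JF[of p], of "- t" a s] by (simp add: bl_simps algebra_simps)
    qed
    obtain B where B: "finite B" "F \<subseteq> span B" using F unfolding flag_def by blast
    have "adjoin F a \<subseteq> span (insert a (insert (J a) B))"
    proof
      fix x assume "x \<in> adjoin F a"
      then obtain p s t where p: "p \<in> F" and x: "x = p + s *\<^sub>R a + t *\<^sub>R J a"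
        unfolding adjoin_def by blast
      let ?S = "span (insert a (insert (J a) B))"
      have "span B \<subseteq> ?S" by (rule span_mono) auto
      then have "p \<in> ?S" using B(2) p by blast
      moreover have "a \<in> ?S" "J a \<in> ?S" by (auto intro: span_base)
      ultimately show "x \<in> ?S" unfolding x by (intro span_add span_scale)
    qed
    thus "\<exists>B. finite B \<and> adjoin F a \<subseteq> span B"
      using B(1) by (intro exI[of _ "insert a (insert (J a) B)"]) simp
    show "\<exists>p\<in>adjoin F a. \<forall>v\<in>adjoin F a. inner (w - p) v = 0" for w
    proof -
      obtain p where p: "p \<in> F" "\<And>v. v \<in> F \<Longrightarrow> inner (w - p) v = 0"
        using F unfolding flag_def by blast
      show ?thesis
      proof (intro bexI ballI)
        show "p + inner w a *\<^sub>R a + inner w (J a) *\<^sub>R J a \<in> adjoin F a" by (rule adjoin_I[OF p(1)])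
        fix v assume "v \<in> adjoin F a"
        then obtain q s t where q: "q \<in> F" "v = q + s *\<^sub>R a + t *\<^sub>R J a"
          unfolding adjoin_def by blast
        have "inner w q = inner p q" using p(2)[OF q(1)] by (simp add: inner_simps)
        then show "inner (w - (p + inner w a *\<^sub>R a + inner w (J a) *\<^sub>R J a)) v = 0"
          using orth[OF q(1)] orthJ[OF q(1)] orth'[OF p(1)] aa
          by (simp add: q(2) inner_simps)
      qed
    qed
    show "compact (adjoin F a \<inter> cball 0 r)" for r
    proof -
      define G where "G = F \<inter> cball 0 r"
      define S where "S = (\<lambda>(s, t). s *\<^sub>R a + t *\<^sub>R J a) ` ({-r..r} \<times> {-r..r})"
      have G: "compact G" using F by (simp add: flag_def G_def)
      have S: "compact S"
        unfolding S_def
        by (intro compact_continuous_image compact_Times compact_Icc)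
           (auto intro!: continuous_intros simp: case_prod_beta)
      \<comment> \<open>By orthogonality a vector of norm at most \<open>r\<close> has all of
        \<open>p\<close>, \<open>s\<close>, \<open>t\<close> bounded by \<open>r\<close>, so it is a
        sum from two compact sets. Intersecting with the closed ball again discards the sums that
        leave it.\<close>
      have "adjoin F a \<inter> cball 0 r = {x + y | x y. x \<in> G \<and> y \<in> S} \<inter> cball 0 r"
      proof (intro equalityI subsetI)
        fix x assume x: "x \<in> adjoin F a \<inter> cball 0 r"
        then obtain p s t where p: "p \<in> F" "x = p + s *\<^sub>R a + t *\<^sub>R J a"
          unfolding adjoin_def by blast
        have "(norm x)\<^sup>2 = (norm p)\<^sup>2 + s\<^sup>2 + t\<^sup>2"
          using orth'[OF p(1)] orth[OF p(1)] orthJ[OF p(1)] aa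
          unfolding power2_norm_eq_inner by (simp add: p(2) inner_simps power2_eq_square)
        moreover have r: "norm x \<le> r" using x by simp
        then have "r \<ge> 0" using norm_ge_zero[of x] by linarith
        moreover have "(norm x)\<^sup>2 \<le> r\<^sup>2" using r by (intro power_mono) auto
        ultimately have "(norm p)\<^sup>2 \<le> r\<^sup>2" "s\<^sup>2 \<le> r\<^sup>2" "t\<^sup>2 \<le> r\<^sup>2"
          using zero_le_power2[of "norm p"] zero_le_power2[of s] zero_le_power2[of t] by linarith+
        then have b: "norm p \<le> r" "\<bar>s\<bar> \<le> r" "\<bar>t\<bar> \<le> r"
          using \<open>r \<ge> 0\<close> by (auto simp: abs_le_square_iff[symmetric])
        then have "p \<in> G" "s *\<^sub>R a + t *\<^sub>R J a \<in> S"
          using p(1) by (auto simp: G_def S_def intro!: image_eqI[of _ _ "(s, t)"])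
        then show "x \<in> {x + y | x y. x \<in> G \<and> y \<in> S} \<inter> cball 0 r"
          using x p(2) by (auto simp: add.assoc)
      next
        fix x assume x: "x \<in> {x + y | x y. x \<in> G \<and> y \<in> S} \<inter> cball 0 r"
        then obtain p s t where "p \<in> F" "x = p + (s *\<^sub>R a + t *\<^sub>R J a)"
          by (auto simp: G_def S_def)
        then show "x \<in> adjoin F a \<inter> cball 0 r"
          using x adjoin_I[of p F s a t] by (simp add: add.assoc)
      qed
      also have "compact \<dots>" by (intro compact_Int_closed compact_sums G S) simp
      finally show ?thesis .
    qed
  qed
qed

lemma flag_residual:
  assumes F: "flag F" and w: "w \<notin> F"
  obtains p r a where "p \<in> F" "w = p + r *\<^sub>R a" "norm a = 1" "\<And>v. v \<in> F \<Longrightarrow> inner a v = 0"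
proof -
  obtain p where p: "p \<in> F" "\<And>v. v \<in> F \<Longrightarrow> inner (w - p) v = 0"
    using F unfolding flag_def by blast
  have "norm (w - p) > 0" using p(1) w by auto
  then show thesis
    using that[OF p(1), of "norm (w - p)" "(1 / norm (w - p)) *\<^sub>R (w - p)"] p(2) by simp
qed

text \<open>Only the component of \<open>w\<close> orthogonal to \<open>F\<close> has to move. A
  reflection carries its direction \<open>a\<close> to a unimodular multiple of \<open>g\<close>,
  and fixes \<open>F\<close> since both vectors are orthogonal to it.\<close>

lemma move_into_adjoin:
  assumes F: "flag F" and g: "norm g = 1" "\<And>v. v \<in> F \<Longrightarrow> inner g v = 0"
  obtains u where "cunitary J u u" "\<And>v. v \<in> F \<Longrightarrow> u v = v" "u w \<in> adjoin F g"
proof (cases "w \<in> F")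
  case True
  then show thesis using that[of id_blinfun] cunitary_id adjoin_superset by auto
next
  case False
  then obtain p r a where p: "p \<in> F" and w: "w = p + r *\<^sub>R a" and a: "norm a = 1"
    and oa: "\<And>v. v \<in> F \<Longrightarrow> inner a v = 0"
    by (rule flag_residual[OF F]) blast
  \<comment> \<open>The projection of \<open>a\<close> to the complex line of \<open>g\<close>.
    Normalised, it has real complex inner product with \<open>a\<close>, as the reflection requires;
    if it vanishes, \<open>g\<close> itself will do.\<close>
  define c where "c = inner a g *\<^sub>R g + inner a (J g) *\<^sub>R J g"
  have "\<exists>s t. norm (s *\<^sub>R g + t *\<^sub>R J g) = 1 \<and> inner a (J (s *\<^sub>R g + t *\<^sub>R J g)) = 0"
  proof (cases "c = 0")
    case True
    have "inner a c = (inner a g)\<^sup>2 + (inner a (J g))\<^sup>2"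
      by (simp add: c_def inner_simps power2_eq_square)
    then have "inner a (J g) = 0" using True by (simp add: sum_power2_eq_zero_iff)
    then show ?thesis using g(1) by (intro exI[of _ 1] exI[of _ 0]) simp
  next
    case False
    have "inner a (J c) = 0" by (simp add: c_def bl_simps inner_simps)
    moreover have "(1 / norm c) *\<^sub>R c = (inner a g / norm c) *\<^sub>R g + (inner a (J g) / norm c) *\<^sub>R J g"
      by (simp add: c_def scaleR_add_right)
    moreover have "norm ((1 / norm c) *\<^sub>R c) = 1" using False by simp
    ultimately show ?thesis
      by (metis (no_types, lifting) blinfun.scaleR_right inner_scaleR_right mult_zero_right)
  qed
  then obtain s t where b: "norm (s *\<^sub>R g + t *\<^sub>R J g) = 1" "inner a (J (s *\<^sub>R g + t *\<^sub>R J g)) = 0"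
    by blast
  let ?b = "s *\<^sub>R g + t *\<^sub>R J g"
  obtain u where u: "cunitary J u u" "u a = ?b"
    "\<And>v. inner v (a - ?b) = 0 \<Longrightarrow> inner v (J (a - ?b)) = 0 \<Longrightarrow> u v = v"
    by (rule reflection[OF a b]) blast
  have uF: "u v = v" if v: "v \<in> F" for v
  proof (rule u(3))
    have "inner v a = 0" "inner v (J a) = 0" "inner v g = 0" "inner v (J g) = 0"
      using oa[OF v] J_orthogonal[OF F oa v] g(2)[OF v] J_orthogonal[OF F g(2) v]
      by (simp_all add: inner_commute)
    then show "inner v (a - ?b) = 0" "inner v (J (a - ?b)) = 0"
      by (simp_all add: inner_simps bl_simps)
  qed
  have "u w = p + (r * s) *\<^sub>R g + (r * t) *\<^sub>R J g"
    by (simp add: w bl_simps uF[OF p] u(2) scaleR_add_right)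
  then have "u w \<in> adjoin F g" using adjoin_I[OF p] by simp
  then show thesis using that u(1) uF by blast
qed

text \<open>Each stage does two jobs: it absorbs the next vector of \<open>d\<close>, and it
  contains a direction \<open>g n\<close> orthogonal to everything before, which serves as room for
  one more vector to be moved in.\<close>

definition flag_sequence :: "(nat \<Rightarrow> 'h) \<Rightarrow> (nat \<Rightarrow> 'h) \<Rightarrow> (nat \<Rightarrow> 'h set) \<Rightarrow> bool" where
  "flag_sequence d g F \<longleftrightarrow> F 0 = {0} \<and> (\<forall>n. flag (F n) \<and> d n \<in> F (Suc n) \<and>
    norm (g n) = 1 \<and> (\<forall>v\<in>F n. inner (g n) v = 0) \<and> adjoin (F n) (g n) \<subseteq> F (Suc n))"

lemma flag_sequence_exists:
  fixes d :: "nat \<Rightarrow> 'h"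
  assumes inf: "\<exists>S::'h set. independent S \<and> infinite S"
  obtains g F where "flag_sequence d g F"
proof -
  have step: "\<exists>F' g. flag F' \<and> e \<in> F' \<and> norm g = 1 \<and> (\<forall>v\<in>F. inner g v = 0) \<and> adjoin F g \<subseteq> F'"
    if F: "flag F" for F e
  proof -
    obtain B where B: "finite B" "F \<subseteq> span B" using F unfolding flag_def by blast
    \<comment> \<open>Otherwise an infinite independent set would lie in the span of a finite
      set.\<close>
    have "F \<noteq> UNIV"
      using inf independent_span_bound[OF B(1)] B(2) by auto
    then obtain w where "w \<notin> F" by blast
    then obtain g where g: "norm g = 1" "\<And>v. v \<in> F \<Longrightarrow> inner g v = 0"
      by (rule flag_residual[OF F]) blast
    have F1: "flag (adjoin F g)" using flag_adjoin[OF F] g by blast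
    have "\<exists>F'. flag F' \<and> e \<in> F' \<and> adjoin F g \<subseteq> F'"
    proof (cases "e \<in> adjoin F g")
      case True thus ?thesis using F1 by blast
    next
      case False
      then obtain p r a where p: "p \<in> adjoin F g" and e: "e = p + r *\<^sub>R a" and a: "norm a = 1"
        and oa: "\<And>v. v \<in> adjoin F g \<Longrightarrow> inner a v = 0"
        by (rule flag_residual[OF F1]) blast
      have "e \<in> adjoin (adjoin F g) a" using adjoin_I[OF p, of r a 0] e by simp
      then show ?thesis using flag_adjoin[OF F1 a oa] adjoin_superset[of "adjoin F g" a] by blast
    qed
    then show ?thesis using g by blast
  qed
  have "\<exists>F. \<forall>n. (flag (F n) \<and> (n = 0 \<longrightarrow> F n = {0})) \<and>
      (\<exists>g. d n \<in> F (Suc n) \<and> norm g = 1 \<and> (\<forall>v\<in>F n. inner g v = 0) \<and> adjoin (F n) g \<subseteq> F (Suc n))"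
  proof (rule dependent_nat_choice)
    show "\<exists>F. flag F \<and> (0 = (0::nat) \<longrightarrow> F = {0})" using flag_0 by blast
    fix F :: "'h set" and n :: nat
    assume "flag F \<and> (n = 0 \<longrightarrow> F = {0})"
    then obtain F' g where "flag F'" "d n \<in> F'" "norm g = 1" "\<forall>v\<in>F. inner g v = 0" "adjoin F g \<subseteq> F'"
      using step by blast
    then show "\<exists>F'. (flag F' \<and> (Suc n = 0 \<longrightarrow> F' = {0})) \<and>
      (\<exists>g. d n \<in> F' \<and> norm g = 1 \<and> (\<forall>v\<in>F. inner g v = 0) \<and> adjoin F g \<subseteq> F')" by blast
  qed
  then obtain F where F: "\<forall>n. (flag (F n) \<and> (n = 0 \<longrightarrow> F n = {0})) \<and>
      (\<exists>g. d n \<in> F (Suc n) \<and> norm g = 1 \<and> (\<forall>v\<in>F n. inner g v = 0) \<and> adjoin (F n) g \<subseteq> F (Suc n))"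
    by (rule exE)
  have "\<exists>g. \<forall>n. d n \<in> F (Suc n) \<and> norm (g n) = 1 \<and> (\<forall>v\<in>F n. inner (g n) v = 0) \<and> adjoin (F n) (g n) \<subseteq> F (Suc n)"
    by (rule choice) (use F in simp)
  then obtain g where g: "\<forall>n. d n \<in> F (Suc n) \<and> norm (g n) = 1 \<and> (\<forall>v\<in>F n. inner (g n) v = 0) \<and> adjoin (F n) (g n) \<subseteq> F (Suc n)"
    by (rule exE)
  have "flag_sequence d g F" unfolding flag_sequence_def using F g by simp
  thus thesis by (rule that)
qed

lemma flag_sequence_mono:
  assumes "flag_sequence d g F" "m \<le> n"
  shows "F m \<subseteq> F n"
  using assms(2)
proof (induction n rule: dec_induct)
  case (step n)
  have "F n \<subseteq> F (Suc n)" using assms(1) adjoin_superset unfolding flag_sequence_def by blast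
  then show ?case using step by blast
qed simp

text \<open>One stage of the flag is spent per vector. The unitaries used later fix
  \<open>F (Suc N)\<close>, so they do not disturb the vectors already placed.\<close>

lemma move_into_flag:
  assumes fs: "flag_sequence d g F"
  shows "length zs = n \<Longrightarrow>
    \<exists>u w. cunitary J u w \<and> (\<forall>v\<in>F N. u v = v) \<and> (\<forall>z\<in>set zs. u z \<in> F (N + n))"
proof (induction n arbitrary: N zs)
  case 0
  then show ?case using cunitary_id by (intro exI[of _ id_blinfun]) simp
next
  case (Suc n)
  then obtain z ys where zs: "zs = z # ys" and ys: "length ys = n" by (auto simp: length_Suc_conv)
  have "flag (F N)" "norm (g N) = 1" "\<And>v. v \<in> F N \<Longrightarrow> inner (g N) v = 0" and sub: "adjoin (F N) (g N) \<subseteq> F (Suc N)"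
    using fs unfolding flag_sequence_def by auto
  from move_into_adjoin[OF this(1-3)] obtain u where u: "cunitary J u u"
    "\<And>v. v \<in> F N \<Longrightarrow> u v = v" "u z \<in> adjoin (F N) (g N)" by blast
  obtain u' w' where u': "cunitary J u' w'" "\<And>v. v \<in> F (Suc N) \<Longrightarrow> u' v = v"
    "\<And>y. y \<in> set ys \<Longrightarrow> u' (u y) \<in> F (N + Suc n)"
    using Suc.IH[of "map u ys" "Suc N"] ys by auto
  have uz: "u z \<in> F (Suc N)" using u(3) sub by blast
  have s: "F (Suc N) \<subseteq> F (N + Suc n)" "F N \<subseteq> F (Suc N)" by (rule flag_sequence_mono[OF fs], simp)+
  have "u' (u v) = v" if "v \<in> F N" for v using that u(2) u'(2) s(2) by auto
  moreover have "u' (u y) \<in> F (N + Suc n)" if "y \<in> set zs" for y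
    using that uz s(1) u'(2)[OF uz] u'(3) by (auto simp: zs)
  ultimately show ?case
    using cunitary_compose[OF u(1) u'(1)]
    by (intro exI[of _ "u' o\<^sub>L u"] exI[of _ "u o\<^sub>L w'"]) auto
qed

end

section \<open>Simultaneous confinement of the images of a dense sequence\<close>

context complex_structure
begin

text \<open>Treating \<open>d m\<close> moves its \<open>q\<close> images, at a cost of
  \<open>q\<close> stages, by a unitary fixing \<open>F (1 + m * q)\<close>. That space contains
  \<open>d 0\<close> up to \<open>d m\<close> and all images placed before, so earlier memberships
  survive the conjugation. The initial stage \<open>1\<close> is spent on putting \<open>v\<close>
  on the line of \<open>g 0\<close>. The bound on the index involves neither \<open>m\<close> nor
  the operators.\<close>

lemma triangularizing_unitary:
  assumes fs: "flag_sequence d g F" and len: "length Ts = q" "q > 0" and v: "norm v = 1"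
  shows "\<exists>u w. cunitary J u w \<and> u v \<in> F 1 \<and> (\<exists>s t. u v = s *\<^sub>R g 0 + t *\<^sub>R J (g 0)) \<and>
    (\<forall>j<m. \<forall>T\<in>set Ts. u (T (w (d j))) \<in> F (1 + Suc j * q))"
proof (induction m)
  case 0
  have F0: "F 0 = {0}" and "flag (F 0)" "norm (g 0) = 1" "\<And>v. v \<in> F 0 \<Longrightarrow> inner (g 0) v = 0"
    and sub: "adjoin (F 0) (g 0) \<subseteq> F 1"
    using fs unfolding flag_sequence_def One_nat_def by blast+
  from move_into_adjoin[OF this(2-4)] obtain u where "cunitary J u u" and u: "u v \<in> adjoin (F 0) (g 0)" by blast
  moreover have "\<exists>s t. u v = s *\<^sub>R g 0 + t *\<^sub>R J (g 0)"
    using u unfolding adjoin_def F0 by auto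
  ultimately show ?case using sub by blast
next
  case (Suc m)
  then obtain u w where u: "cunitary J u w" and uv: "u v \<in> F 1" "\<exists>s t. u v = s *\<^sub>R g 0 + t *\<^sub>R J (g 0)"
    and ud: "\<And>j T. j < m \<Longrightarrow> T \<in> set Ts \<Longrightarrow> u (T (w (d j))) \<in> F (1 + Suc j * q)" by blast
  let ?N = "1 + m * q"
  obtain u' w' where u': "cunitary J u' w'" "\<And>v. v \<in> F ?N \<Longrightarrow> u' v = v"
    and u'z: "\<And>z. z \<in> set (map (\<lambda>T. u (T (w (d m)))) Ts) \<Longrightarrow> u' z \<in> F (?N + q)"
    using move_into_flag[OF fs, of "map (\<lambda>T. u (T (w (d m)))) Ts" q ?N] len by auto
  have w'v: "w' v = v" if "v \<in> F ?N" for v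
    using cunitary_inverse(1)[OF u'(1), of v] u'(2)[OF that] by simp
  \<comment> \<open>Here \<open>q > 0\<close> matters: \<open>d j\<close> lies in
    \<open>F (Suc j)\<close>, and \<open>j \<le> m * q\<close> is needed for this to be contained in
    \<open>F (1 + m * q)\<close>.\<close>
  have dN: "d j \<in> F ?N" if "j \<le> m" for j
  proof -
    have "d j \<in> F (Suc j)" using fs unfolding flag_sequence_def by blast
    moreover have "j \<le> m * q" using that len(2) by (metis le_trans mult_le_mono2 mult_1_right Suc_leI One_nat_def)
    then have "F (Suc j) \<subseteq> F ?N" by (intro flag_sequence_mono[OF fs]) simp
    ultimately show ?thesis by blast
  qed
  have "u' (u (T (w (w' (d j))))) \<in> F (1 + Suc j * q)" if j: "j < Suc m" and T: "T \<in> set Ts" for j T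
  proof (cases "j = m")
    case True
    then show ?thesis using w'v[OF dN, of m] u'z T by (simp add: add.commute)
  next
    case False
    then have jm: "j < m" using j by simp
    have "Suc j * q \<le> m * q" using jm by (intro mult_le_mono1) simp
    then have "F (1 + Suc j * q) \<subseteq> F ?N" by (intro flag_sequence_mono[OF fs]) simp
    then show ?thesis using w'v[OF dN, of j] jm u'(2) ud[OF jm T] by auto
  qed
  moreover have "F 1 \<subseteq> F ?N" by (rule flag_sequence_mono[OF fs]) simp
  then have "u' (u v) = u v" using u'(2) uv(1) by blast
  ultimately show ?case
    using cunitary_compose[OF u u'(1)] uv
    by (intro exI[of _ "u' o\<^sub>L u"] exI[of _ "w o\<^sub>L w'"]) auto
qed

text \<open>\<open>w g\<close> is \<open>v\<close> times the conjugate of the phase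
  \<open>s + i t\<close>, which has modulus one. Hence the conjugated operator is as large at the
  fixed vector \<open>g\<close> as \<open>T\<close> is at \<open>v\<close>, whatever the
  phase.\<close>

lemma norm_conj_phase:
  assumes u: "cunitary J u w" and v: "norm v = 1" and g: "norm g = 1"
    and uv: "u v = s *\<^sub>R g + t *\<^sub>R J g" and T: "cbl J T"
  shows "norm (u (T (w g))) = norm (T v)"
proof -
  have nu: "norm (u x) = norm x" and uJ: "u (J x) = J (u x)" for x
    using u by (simp_all add: cunitary_def cbl_iff)
  have "(norm (u v))\<^sup>2 = s\<^sup>2 + t\<^sup>2"
    unfolding uv norm_complex_combination using g by simp
  then have st: "s\<^sup>2 + t\<^sup>2 = 1" by (simp add: nu v)
  have "u (s *\<^sub>R v + (- t) *\<^sub>R J v) = (s\<^sup>2 + t\<^sup>2) *\<^sub>R g"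
    by (simp add: bl_simps uJ uv algebra_simps power2_eq_square)
  then have "u (s *\<^sub>R v + (- t) *\<^sub>R J v) = g" using st by simp
  then have "w g = s *\<^sub>R v + (- t) *\<^sub>R J v" using cunitary_inverse(1)[OF u] by metis
  then have "T (w g) = s *\<^sub>R T v + (- t) *\<^sub>R J (T v)"
    using T by (simp add: bl_simps cbl_iff)
  then have "(norm (T (w g)))\<^sup>2 = (norm (T v))\<^sup>2"
    using norm_complex_combination[of s "T v" "- t"] st by simp
  then show ?thesis by (simp add: nu)
qed

end

section \<open>Strongly convergent subsequences\<close>

lemma Cauchy_of_dense:
  fixes T :: "nat \<Rightarrow> 'a::real_normed_vector \<Rightarrow>\<^sub>L 'b::real_normed_vector"
  assumes R: "\<And>n. norm (T n) \<le> R" and dense: "closure D = UNIV"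
    and conv: "\<And>d. d \<in> D \<Longrightarrow> convergent (\<lambda>n. T n d)"
  shows "Cauchy (\<lambda>n. T n v)"
proof (rule CauchyI)
  fix e :: real assume e: "e > 0"
  have R0: "R \<ge> 0" using R[of 0] norm_ge_zero order_trans by blast
  have "v \<in> closure D" using dense by simp
  moreover have "e / (3 * (R + 1)) > 0" using e R0 by simp
  ultimately obtain d where d: "d \<in> D" "dist d v < e / (3 * (R + 1))"
    unfolding closure_approachable by blast
  have le: "norm (T n (v - d)) < e / 3" for n
  proof -
    have "norm (T n (v - d)) \<le> norm (T n) * norm (v - d)" by (rule norm_blinfun)
    also have "\<dots> \<le> (R + 1) * norm (v - d)" using R[of n] by (intro mult_right_mono) auto
    also have "\<dots> < (R + 1) * (e / (3 * (R + 1)))"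
      using d(2) R0 by (intro mult_strict_left_mono) (auto simp: dist_norm norm_minus_commute)
    also have "\<dots> = e / 3" using R0 by (simp add: divide_simps)
    finally show ?thesis .
  qed
  have "Cauchy (\<lambda>n. T n d)" using conv[OF d(1)] by (rule convergent_Cauchy)
  then obtain M where M: "\<And>m n. m \<ge> M \<Longrightarrow> n \<ge> M \<Longrightarrow> norm (T m d - T n d) < e / 3"
    using CauchyD[of "\<lambda>n. T n d" "e / 3"] e by auto
  have "norm (T m v - T n v) < e" if "m \<ge> M" "n \<ge> M" for m n
  proof -
    have "T m v - T n v = T m (v - d) + (T m d - T n d) - T n (v - d)"
      by (simp add: bl_simps)
    then have "norm (T m v - T n v) \<le> norm (T m (v - d)) + norm (T m d - T n d) + norm (T n (v - d))"
      by (simp only:) (intro order_trans[OF norm_triangle_ineq4] add_right_mono norm_triangle_ineq)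
    then show ?thesis using le[of m] le[of n] M[OF that] by linarith
  qed
  then show "\<exists>M. \<forall>m\<ge>M. \<forall>n\<ge>M. norm (T m v - T n v) < e" by blast
qed

lemma strong_limit:
  fixes T :: "nat \<Rightarrow> 'h::{real_normed_vector, complete_space} \<Rightarrow>\<^sub>L 'h"
  assumes R: "\<And>n. norm (T n) \<le> R" and J: "\<And>n. cbl J (T n)"
    and Cauchy: "\<And>v. Cauchy (\<lambda>n. T n v)"
  obtains S where "cbl J S" "norm S \<le> R" "\<And>v. (\<lambda>n. T n v) \<longlonglongrightarrow> S v"
proof -
  have R0: "R \<ge> 0" using R[of 0] norm_ge_zero order_trans by blast
  define S where "S v = lim (\<lambda>n. T n v)" for v
  have S: "(\<lambda>n. T n v) \<longlonglongrightarrow> S v" for v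
    unfolding S_def using Cauchy_convergent[OF Cauchy] convergent_LIMSEQ_iff by blast
  have bound: "norm (S v) \<le> norm v * R" for v
  proof (rule LIMSEQ_le_const2[OF tendsto_norm[OF S]], intro exI allI impI)
    fix n :: nat
    show "norm (T n v) \<le> norm v * R"
      using norm_blinfun[of "T n" v] mult_left_mono[OF R[of n] norm_ge_zero[of v]] by (simp add: mult.commute)
  qed
  have lin: "bounded_linear S"
  proof (rule bounded_linear_intro[OF _ _ bound])
    fix x y :: 'h and c :: real
    show "S (x + y) = S x + S y"
      by (rule LIMSEQ_unique[OF S]) (use tendsto_add[OF S S] in \<open>simp add: bl_simps\<close>)
    show "S (c *\<^sub>R x) = c *\<^sub>R S x"
      by (rule LIMSEQ_unique[OF S]) (use tendsto_scaleR[OF tendsto_const S] in \<open>simp add: bl_simps\<close>)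
  qed
  note SB = bounded_linear_Blinfun_apply[OF lin]
  show thesis
  proof (rule that[of "Blinfun S"])
    have "S (J v) = J (S v)" for v
    proof (rule LIMSEQ_unique[OF S])
      have "(\<lambda>n. J (T n v)) \<longlonglongrightarrow> J (S v)" by (intro blinfun.tendsto tendsto_const S)
      then show "(\<lambda>n. T n (J v)) \<longlonglongrightarrow> J (S v)" using J by (simp add: cbl_iff)
    qed
    then show "cbl J (Blinfun S)" by (simp add: cbl_iff SB)
    show "norm (Blinfun S) \<le> R"
      by (rule norm_blinfun_bound[OF R0]) (use bound in \<open>simp add: SB mult.commute\<close>)
    show "(\<lambda>n. T n v) \<longlonglongrightarrow> Blinfun S v" for v using S by (simp add: SB)
  qed
qed

text \<open>A diagonal argument over pairs of an operator index and a dense vector, enumerated by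
  \<open>from_nat\<close>. The uniform norm bound extends convergence from the dense sequence to all
  vectors.\<close>

lemma strong_subsequence:
  fixes T :: "nat \<Rightarrow> 'i::finite \<Rightarrow> 'h::{real_normed_vector, complete_space} \<Rightarrow>\<^sub>L 'h"
  assumes R: "\<And>n i. norm (T n i) \<le> R i" and J: "\<And>n i. cbl J (T n i)"
    and dense: "closure (range d) = UNIV"
    and K: "\<And>m i. compact (K m i)" "\<And>m i n. m < n \<Longrightarrow> T n i (d m) \<in> K m i"
  obtains r S where "strict_mono r" "\<And>i. cbl J (S i)" "\<And>i. norm (S i) \<le> R i"
    "\<And>i v. (\<lambda>n. T (r n) i v) \<longlonglongrightarrow> S i v"
proof -
  define P where "P k s = (case from_nat k of (i, m) \<Rightarrow> convergent (\<lambda>n. T (s n) i (d m)))"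
    for k :: nat and s :: "nat \<Rightarrow> nat"
  interpret subseqs P
  proof
    fix k :: nat and s :: "nat \<Rightarrow> nat" assume s: "strict_mono s"
    obtain i m where im: "from_nat k = (i :: 'i, m :: nat)" by fastforce
    \<comment> \<open>Membership in \<open>K m i\<close> holds only for indices above
      \<open>m\<close>, so the first \<open>Suc m\<close> terms are dropped; a strictly increasing
      \<open>s\<close> keeps the remaining indices large enough.\<close>
    have "\<forall>n. T (s (n + Suc m)) i (d m) \<in> K m i"
    proof
      fix n
      have "n + Suc m \<le> s (n + Suc m)" using s by (rule strict_mono_imp_increasing)
      then show "T (s (n + Suc m)) i (d m) \<in> K m i" by (intro K(2)) simp
    qed
    then obtain l r where r: "strict_mono r" "((\<lambda>n. T (s (n + Suc m)) i (d m)) \<circ> r) \<longlonglongrightarrow> l"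
      using compact_imp_seq_compact[OF K(1)[of m i]] unfolding seq_compact_def by metis
    show "\<exists>r'. strict_mono r' \<and> P k (s \<circ> r')"
    proof (intro exI[of _ "\<lambda>n. r n + Suc m"] conjI)
      show "strict_mono (\<lambda>n. r n + Suc m)" using r(1) by (simp add: strict_mono_def)
      show "P k (s \<circ> (\<lambda>n. r n + Suc m))"
        using r(2) by (auto simp: P_def im convergent_def o_def)
    qed
  qed
  have conv: "convergent (\<lambda>n. T (diagseq n) i (d m))" for i m
  proof -
    define k where "k = to_nat (i, m)"
    \<comment> \<open>The requirement numbered \<open>k\<close> is guaranteed only for the tail from
      \<open>Suc k\<close> on; convergence does not depend on the omitted terms.\<close>
    have "P k (diagseq \<circ> ((+) (Suc k)))"
    proof (rule diagseq_holds)
      fix r s :: "nat \<Rightarrow> nat" and n assume "strict_mono r" "P n s"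
      then show "P n (s \<circ> r)"
        unfolding P_def by (auto split: prod.splits dest: convergent_subseq_convergent simp: o_def)
    qed
    then have "convergent (\<lambda>n. T (diagseq (n + Suc k)) i (d m))"
      by (simp add: P_def k_def o_def add.commute)
    then show ?thesis
      using convergent_ignore_initial_segment[of "\<lambda>n. T (diagseq n) i (d m)" "Suc k"] by simp
  qed
  have C: "Cauchy (\<lambda>n. T (diagseq n) i v)" for i v
    by (rule Cauchy_of_dense[where R = "R i" and D = "range d"]) (use R dense conv in auto)
  have "\<exists>S. cbl J S \<and> norm S \<le> R i \<and> (\<forall>v. (\<lambda>n. T (diagseq n) i v) \<longlonglongrightarrow> S v)" for i
    by (rule strong_limit[of "\<lambda>n. T (diagseq n) i" "R i" J]) (use R J C in auto)
  then obtain S where "\<And>i. cbl J (S i)" "\<And>i. norm (S i) \<le> R i"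
    "\<And>i v. (\<lambda>n. T (diagseq n) i v) \<longlonglongrightarrow> S i v" by metis
  then show thesis using that subseq_diagseq by blast
qed

subsection \<open>Passage to the strong limit\<close>

text \<open>A basic strong neighbourhood tests finitely many vectors in finitely many coordinates,
  so one late term of the sequence passes all tests.\<close>

lemma sot_closed_limit:
  fixes y :: "('h::real_normed_vector \<Rightarrow>\<^sub>L 'h)^'d"
  assumes S: "sot_closed J S" and y: "y \<in> BH J" and X: "\<And>n. X n \<in> S"
    and lim: "\<And>i v. (\<lambda>n. (X n $ i) v) \<longlonglongrightarrow> (y $ i) v"
  shows "y \<in> S"
proof -
  have "\<exists>z\<in>S. \<forall>i. \<forall>v\<in>G. norm ((y$i) v - blinfun_apply (z$i) v) < e" if "finite G" "e > 0" for G e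
  proof -
    have "\<forall>\<^sub>F n in sequentially. norm ((y$i) v - (X n$i) v) < e" for i v
      using tendstoD[OF lim \<open>e > 0\<close>] by (simp add: dist_norm norm_minus_commute)
    then have "\<forall>\<^sub>F n in sequentially. \<forall>i. \<forall>v\<in>G. norm ((y$i) v - (X n$i) v) < e"
      using that(1) by (intro eventually_all_finite eventually_ball_finite) auto
    then obtain n where "\<forall>i. \<forall>v\<in>G. norm ((y$i) v - (X n$i) v) < e"
      by (auto simp: eventually_sequentially)
    then show ?thesis using X by blast
  qed
  then show ?thesis using S y unfolding sot_closed_def by blast
qed

lemma sot_cont_on_limit:
  fixes y :: "('h::real_normed_vector \<Rightarrow>\<^sub>L 'h)^'d" and f :: "_ \<Rightarrow> ('h \<Rightarrow>\<^sub>L 'h)^'r"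
  assumes f: "sot_cont_on S f" and y: "y \<in> S" and X: "\<And>n. X n \<in> S"
    and lim: "\<And>i v. (\<lambda>n. (X n $ i) v) \<longlonglongrightarrow> (y $ i) v"
  shows "(\<lambda>n. (f (X n) $ j) v) \<longlonglongrightarrow> (f y $ j) v"
proof (rule tendstoI)
  fix e :: real assume "e > 0"
  with f[unfolded sot_cont_on_def, rule_format, OF y, of "{v}" e]
  obtain G \<delta> where G: "finite G" "\<delta> > 0"
    and fz: "\<And>z. z \<in> S \<Longrightarrow> \<forall>i. \<forall>v\<in>G. norm ((z$i) v - (y$i) v) < \<delta> \<Longrightarrow> norm ((f z $ j) v - (f y $ j) v) < e"
    by auto
  have "\<forall>\<^sub>F n in sequentially. norm ((X n$i) v - (y$i) v) < \<delta>" for i v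
    using tendstoD[OF lim G(2)] by (simp add: dist_norm)
  then have "\<forall>\<^sub>F n in sequentially. \<forall>i. \<forall>v\<in>G. norm ((X n$i) v - (y$i) v) < \<delta>"
    using G(1) by (intro eventually_all_finite eventually_ball_finite) auto
  then show "\<forall>\<^sub>F n in sequentially. dist ((f (X n) $ j) v) ((f y $ j) v) < e"
    by eventually_elim (use fz X in \<open>simp add: dist_norm\<close>)
qed

text \<open>The norm need not be attained in infinite dimension; any constant below \<open>1\<close>
  could stand in place of \<open>1/2\<close>.\<close>

lemma almost_norming_vector:
  fixes T :: "'a::real_normed_vector \<Rightarrow>\<^sub>L 'b::real_normed_vector"
  assumes "norm T = 1"
  obtains v where "norm v = 1" "norm (T v) \<ge> 1/2"
proof -
  have "\<exists>v. norm v = 1 \<and> norm (T v) \<ge> 1/2"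
  proof (rule ccontr)
    assume "\<not> ?thesis"
    then have *: "norm v = 1 \<Longrightarrow> norm (T v) < 1/2" for v by force
    have "norm (T v) \<le> 1/2 * norm v" for v
    proof (cases "v = 0")
      case False
      have "norm (T ((1 / norm v) *\<^sub>R v)) < 1/2" by (rule *) (use False in simp)
      then show ?thesis using False by (simp add: bl_simps field_simps)
    qed simp
    then have "norm T \<le> 1/2" by (intro norm_blinfun_bound) auto
    then show False using assms by simp
  qed
  then show thesis using that by blast
qed

lemma strong_exhaustion_splitting:
  assumes exh: "strong_exhaustion J \<Omega> \<Omega>k" and x: "x \<in> \<Omega>k k"
  obtains P Q A B where "splitting J P Q A B"
proof -
  have "\<And>n. enat n < 2 \<Longrightarrow> x \<in> \<Omega>k k" "(1::enat) \<le> 2"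
    using x by (simp_all add: numeral_eq_enat one_enat_def)
  then obtain u where "unitary_to_sum J 2 u"
    using strong_exhaustion_direct_sum[OF exh, of 2 "\<lambda>_. x" k] by blast
  then show thesis using unitary_to_sum_2_splitting that by metis
qed

lemma unit_inv_conj:
  assumes "unit_inv J S" "x \<in> S" "cunitary J u w"
  shows "(\<chi> i. u o\<^sub>L x$i o\<^sub>L w) \<in> S"
  using assms cunitary_sym[OF assms(3)] unfolding unit_inv_def by blast

theorem theorem2p4:
  fixes J :: "'h::{real_inner,complete_space} \<Rightarrow>\<^sub>L 'h"
    and \<Omega> :: "(('h \<Rightarrow>\<^sub>L 'h)^'d) set"
    and f :: "('h \<Rightarrow>\<^sub>L 'h)^'d \<Rightarrow> ('h \<Rightarrow>\<^sub>L 'h)^'r"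
  assumes J_sq: "\<forall>v. blinfun_apply J (blinfun_apply J v) = - v"
    and J_orth: "\<forall>v w. inner (blinfun_apply J v) (blinfun_apply J w) = inner v w"
    and separable: "\<exists>D::'h set. countable D \<and> closure D = UNIV"
    and inf_dim: "\<exists>S::'h set. independent S \<and> infinite S"
    and strong: "strong_nc_function J \<Omega> f"
    and inj: "\<forall>x\<in>\<Omega>. \<forall>L. has_fderiv J \<Omega> f x L \<longrightarrow> inj_on L (BH J)"
  shows "\<forall>x\<in>\<Omega>. \<forall>L. has_fderiv J \<Omega> f x L \<longrightarrow> bounded_below_on (BH J) L"
proof (intro ballI allI impI)
  fix x L assume x: "x \<in> \<Omega>" and L: "has_fderiv J \<Omega> f x L"
  interpret complex_structure J
    by unfold_locales (use J_sq J_orth in auto)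
  obtain \<Omega>k where nc: "nc_function J \<Omega> f" and exh: "strong_exhaustion J \<Omega> \<Omega>k"
    and cont: "\<And>k. sot_cont_on (\<Omega>k k) f"
    using strong unfolding strong_nc_function_def by blast
  obtain k where xk: "x \<in> \<Omega>k k"
    using x exh unfolding strong_exhaustion_def nc_exhaustion_def by blast
  obtain P Q A B where "splitting J P Q A B"
    by (rule strong_exhaustion_splitting[OF exh xk])
  then interpret nc_calculus J P Q A B \<Omega> f \<Omega>k
    by (intro nc_calculus.intro nc_calculus_axioms.intro nc exh)
  obtain \<epsilon> where \<epsilon>: "\<epsilon> > 0" and reg: "\<And>x y. x \<in> \<Omega>k k \<Longrightarrow> y \<in> \<Omega>k k \<Longrightarrow> admissible \<epsilon> x y"
    and Z: "\<And>x y h. x \<in> \<Omega>k k \<Longrightarrow> y \<in> \<Omega>k k \<Longrightarrow> h \<in> BH J \<Longrightarrow> tnorm h < \<epsilon> \<Longrightarrow> Z x h y \<in> \<Omega>k (Suc k)"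
    and xh: "\<And>x h. x \<in> \<Omega>k k \<Longrightarrow> h \<in> BH J \<Longrightarrow> tnorm h < \<epsilon> \<Longrightarrow> x + h \<in> \<Omega>k (Suc k)"
    by (rule admissible_\<Omega>k[of k]) blast
  \<comment> \<open>From here the corner formula is available for the given
    \<open>L\<close>.\<close>
  have L_eq: "L h = ncderiv x x h" if "h \<in> BH J" for h
    by (rule has_fderiv_unique[OF L has_fderiv_ncderiv[OF x] \<epsilon> _ that]) (use xh[OF xk] \<Omega>k_\<Omega> in blast)
  note regx = reg[OF xk xk]
  show "bounded_below_on (BH J) L"
  proof (rule ccontr)
    assume nb: "\<not> bounded_below_on (BH J) L"
    have "\<exists>h\<in>BH J. tnorm h = 1 \<and> tnorm (ncderiv x x h) < 1 / real (Suc n)" for n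
    proof -
      obtain h where h: "h \<in> BH J" "tnorm (L h) < 1 / real (Suc n) * tnorm h"
        using nb unfolding bounded_below_on_def by (metis not_le of_nat_0_less_iff zero_less_Suc zero_less_divide_1_iff)
      have "1 / real (Suc n) * tnorm h > 0" using h(2) tnorm_nonneg le_less_trans by blast
      then have t: "tnorm h > 0" by (simp add: zero_less_divide_iff)
      have "tnorm (ncderiv x x ((1 / tnorm h) *\<^sub>R h)) = tnorm (L h) / tnorm h"
        using t by (simp add: ncderiv_scaleR[OF regx h(1)] L_eq[OF h(1)] tnorm_scaleR)
      also have "\<dots> < 1 / real (Suc n)" using h(2) t by (simp add: pos_divide_less_eq)
      finally show ?thesis
        using t h(1) by (intro bexI[of _ "(1 / tnorm h) *\<^sub>R h"]) (auto simp: tnorm_scaleR intro: BH_scaleR)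
    qed
    then obtain h where h: "\<And>n. h n \<in> BH J" "\<And>n. tnorm (h n) = 1"
      and deriv_h: "\<And>n. tnorm (ncderiv x x (h n)) < 1 / real (Suc n)" by metis
    have "\<exists>i v. norm v = 1 \<and> norm ((h n $ i) v) \<ge> 1/2" for n
    proof -
      obtain i where "norm (h n $ i) = 1" using tnorm_attained[of "h n"] h(2)[of n] by auto
      then obtain v where "norm v = 1" "norm ((h n $ i) v) \<ge> 1/2" by (rule almost_norming_vector)
      then show ?thesis by blast
    qed
    then obtain \<iota> v where v: "\<And>n. norm (v n) = 1" and hv: "\<And>n. norm ((h n $ \<iota> n) (v n)) \<ge> 1/2" by metis
    obtain D :: "'h set" where D: "countable D" "closure D = UNIV" using separable by blast
    define d where "d = from_nat_into D"
    have "D \<noteq> {}" using D(2) by auto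
    then have d: "range d = D" using D(1) by (simp add: d_def)
    obtain g F where fs: "flag_sequence d g F" by (rule flag_sequence_exists[OF inf_dim])
    have g: "norm (g 0) = 1" and flagF: "\<And>n. flag (F n)"
      using fs unfolding flag_sequence_def by blast+
    \<comment> \<open>The coordinates of \<open>x\<close> and of \<open>h n\<close> must be
      conjugated by the same unitary, hence the doubled index type and \<open>q\<close> operators
      per stage.\<close>
    obtain js :: "('d + 'd) list" where js: "set js = UNIV" using finite_list[of "UNIV :: ('d + 'd) set"] by auto
    define q where "q = length js"
    have q: "q > 0" using js by (auto simp: q_def)
    define X where "X n i = (case i of Inl i \<Rightarrow> x $ i | Inr i \<Rightarrow> h n $ i)" for n i
    have XJ: "cbl J (X n i)" for n i
      using \<Omega>k_BH[OF xk] h(1)[of n] by (auto simp: X_def BH_def split: sum.splits)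
    \<comment> \<open>The \<open>n\<close>-th unitary takes care of the first \<open>n\<close> dense
      vectors only, which suffices: each \<open>d j\<close> is treated by all but finitely many
      \<open>n\<close>.\<close>
    have "\<exists>u w. cunitary J u w \<and> (\<exists>s t. u (v n) = s *\<^sub>R g 0 + t *\<^sub>R J (g 0)) \<and>
      (\<forall>j<n. \<forall>i. u (X n i (w (d j))) \<in> F (1 + Suc j * q))" for n
    proof -
      have "length (map (\<lambda>i. blinfun_apply (X n i)) js) = q" by (simp add: q_def)
      from triangularizing_unitary[OF fs this q v, of n n] obtain u w where uw: "cunitary J u w"
        "\<exists>s t. u (v n) = s *\<^sub>R g 0 + t *\<^sub>R J (g 0)"
        "\<forall>j<n. \<forall>T\<in>set (map (\<lambda>i. blinfun_apply (X n i)) js). u (T (w (d j))) \<in> F (1 + Suc j * q)"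
        by blast
      have "\<forall>j<n. \<forall>i. u (X n i (w (d j))) \<in> F (1 + Suc j * q)" using uw(3) js by simp
      with uw(1,2) show ?thesis by blast
    qed
    then obtain u w where u: "\<And>n. cunitary J (u n) (w n)"
      and uv: "\<And>n. \<exists>s t. u n (v n) = s *\<^sub>R g 0 + t *\<^sub>R J (g 0)"
      and ud: "\<And>n j i. j < n \<Longrightarrow> u n (X n i (w n (d j))) \<in> F (1 + Suc j * q)" by metis
    define T where "T n i = u n o\<^sub>L X n i o\<^sub>L w n" for n i
    define R where "R i = (case i of Inl i \<Rightarrow> norm (x $ i) | Inr i \<Rightarrow> 1)" for i :: "'d + 'd"
    have TR: "norm (T n i) \<le> R i" for n i
    proof -
      have "norm (T n i) \<le> norm (X n i)" unfolding T_def by (rule norm_conj_le[OF u])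
      also have "\<dots> \<le> R i"
        using component_le_tnorm[of "h n"] h(2)[of n] by (auto simp: X_def R_def split: sum.splits)
      finally show ?thesis .
    qed
    have TJ: "cbl J (T n i)" for n i
      using XJ[of n i] u[of n] cunitary_sym[OF u[of n]] by (simp add: T_def cbl_iff cunitary_def)
    have Tcompact: "T n i (d m) \<in> F (1 + Suc m * q) \<inter> cball 0 (R i * norm (d m))" if "m < n" for n m i
    proof -
      have "norm (T n i (d m)) \<le> R i * norm (d m)"
        using norm_blinfun[of "T n i" "d m"] mult_right_mono[OF TR norm_ge_zero] order_trans by blast
      then show ?thesis using ud[OF that, of i] by (simp add: T_def)
    qed
    obtain r S where r: "strict_mono r" and SJ: "\<And>i. cbl J (S i)" and SR: "\<And>i. norm (S i) \<le> R i"
      and lim: "\<And>i v. (\<lambda>n. T (r n) i v) \<longlonglongrightarrow> S i v"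
    proof (rule strong_subsequence[of T R J d "\<lambda>m i. F (1 + Suc m * q) \<inter> cball 0 (R i * norm (d m))"])
      show "compact (F (1 + Suc m * q) \<inter> cball 0 (R i * norm (d m)))" for m i
        using flagF unfolding flag_def by blast
    qed (use TR TJ d D Tcompact in auto)
    define xs where "xs n = (\<chi> i. T n (Inl i))" for n
    define hs where "hs n = (\<chi> i. T n (Inr i))" for n
    define y where "y = (\<chi> i. S (Inl i))"
    define h' where "h' = (\<chi> i. S (Inr i))"
    have xs_eq: "xs n = (\<chi> i. u n o\<^sub>L x$i o\<^sub>L w n)" for n
      by (simp add: xs_def T_def X_def)
    have xs: "xs n \<in> \<Omega>k k" for n
      unfolding xs_eq by (rule unit_inv_conj[OF unit_inv xk u])
    have yBH: "y \<in> BH J" and h'BH: "h' \<in> BH J" and hsBH: "hs n \<in> BH J" for n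
      using SJ TJ by (auto simp: y_def h'_def hs_def BH_def)
    have y: "y \<in> \<Omega>k k"
    proof (rule sot_closed_limit[of J "\<Omega>k k" y "\<lambda>n. xs (r n)"])
      show "sot_closed J (\<Omega>k k)" using exh unfolding strong_exhaustion_def by blast
    qed (use yBH xs lim in \<open>auto simp: xs_def y_def\<close>)
    \<comment> \<open>One scale for all \<open>n\<close> and for the limit, so that every block
      point formed with a direction of norm at most \<open>1\<close> lies in
      \<open>\<Omega>k (Suc k)\<close>.\<close>
    define t where "t = \<epsilon> / 2"
    have t: "t > 0" "t < \<epsilon>" using \<epsilon> by (auto simp: t_def)
    have small: "tnorm (t *\<^sub>R a) < \<epsilon>" if "tnorm a \<le> 1" for a :: "('h \<Rightarrow>\<^sub>L 'h)^'d"
    proof -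
      have "tnorm (t *\<^sub>R a) \<le> t * 1" unfolding tnorm_scaleR using t that by (intro mult_mono) auto
      then show ?thesis using t by simp
    qed
    have hs1: "tnorm (t *\<^sub>R hs n) < \<epsilon>" for n
      by (rule small) (use TR[of n "Inr _"] in \<open>auto simp: tnorm_le_iff hs_def R_def\<close>)
    have h'1: "tnorm (t *\<^sub>R h') < \<epsilon>"
      by (rule small) (use SR[of "Inr _"] in \<open>auto simp: tnorm_le_iff h'_def R_def\<close>)
    have hn1: "tnorm (t *\<^sub>R h n) < \<epsilon>" for n by (rule small) (simp add: h)
    have Zn: "Z (xs n) (t *\<^sub>R hs n) (xs n) \<in> \<Omega>k (Suc k)" for n
      by (intro Z xs hs1 BH_scaleR hsBH)
    have Zy: "Z y (t *\<^sub>R h') y \<in> \<Omega>k (Suc k)"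
      by (intro Z y h'1 BH_scaleR h'BH)
    have Zx: "Z x (t *\<^sub>R h n) x \<in> \<Omega>k (Suc k)" for n
      by (intro Z xk hn1 BH_scaleR h)
    \<comment> \<open>The block points and their limit lie in the single set
      \<open>\<Omega>k (Suc k)\<close>, where \<open>f\<close> is strongly continuous; since the
      splitting is fixed, the blocks converge as soon as their entries do.\<close>
    have "(\<lambda>n. (f (Z (xs (r n)) (t *\<^sub>R hs (r n)) (xs (r n))) $ j) z) \<longlonglongrightarrow> (f (Z y (t *\<^sub>R h') y) $ j) z" for j z
    proof (rule sot_cont_on_limit[OF cont Zy Zn])
      show "(\<lambda>n. (Z (xs (r n)) (t *\<^sub>R hs (r n)) (xs (r n)) $ i) v) \<longlonglongrightarrow> (Z y (t *\<^sub>R h') y $ i) v" for i v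
        unfolding Z_apply
        by (simp add: xs_def hs_def y_def h'_def bl_simps)
           (intro tendsto_add tendsto_scaleR tendsto_const blinfun.tendsto[OF tendsto_const] lim)
    qed
    then have lim1: "(\<lambda>n. (ncdiff (xs (r n)) (xs (r n)) (t *\<^sub>R hs (r n)) $ j) z) \<longlonglongrightarrow> (ncdiff y y (t *\<^sub>R h') $ j) z" for j z
      unfolding ncdiff_apply by (rule blinfun.tendsto[OF tendsto_const])
    have bound: "norm ((ncdiff (xs n) (xs n) (t *\<^sub>R hs n) $ j) z) \<le> t * norm z * (1 / real (Suc n))" for n j z
    proof -
      \<comment> \<open>Unitary equivalence transports the smallness of the derivative at
        \<open>x\<close> to the moving point \<open>xs n\<close>; writing \<open>z\<close> as
        \<open>u n (w n z)\<close> brings it into the form in which the corner is natural.\<close>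
      note ui = cunitary_inverse[OF u[of n]]
      have "(ncdiff (xs n) (xs n) (t *\<^sub>R hs n) $ j) (u n (w n z)) = u n ((ncdiff x x (t *\<^sub>R h n) $ j) (w n z))"
      proof (rule ncdiff_conj)
        show "cbl J (u n)" using u unfolding cunitary_def by blast
      qed (use Zn Zx \<Omega>k_\<Omega> in \<open>auto simp: xs_def hs_def T_def X_def ui bl_simps\<close>)
      then have "norm ((ncdiff (xs n) (xs n) (t *\<^sub>R hs n) $ j) z) = norm ((ncdiff x x (t *\<^sub>R h n) $ j) (w n z))"
        using u[of n] ui by (simp add: cunitary_def)
      also have "\<dots> \<le> norm (ncdiff x x (t *\<^sub>R h n) $ j) * norm (w n z)" by (rule norm_blinfun)
      also have "norm (w n z) = norm z" using cunitary_sym[OF u[of n]] by (simp add: cunitary_def)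
      also have "norm (ncdiff x x (t *\<^sub>R h n) $ j) * norm z \<le> (t * (1 / real (Suc n))) * norm z"
      proof (intro mult_right_mono norm_ge_zero)
        have "ncdiff x x (t *\<^sub>R h n) = t *\<^sub>R ncderiv x x (h n)"
          by (rule ncderiv_eq[OF regx h(1) t(1)]) (use h(2) t(2) in simp)
        then have "norm (ncdiff x x (t *\<^sub>R h n) $ j) \<le> t * tnorm (ncderiv x x (h n))"
          using component_le_tnorm[of "ncdiff x x (t *\<^sub>R h n)" j] t(1) by (simp add: tnorm_scaleR)
        also have "\<dots> \<le> t * (1 / real (Suc n))"
          by (rule mult_left_mono) (use deriv_h[of n] t in auto)
        finally show "norm (ncdiff x x (t *\<^sub>R h n) $ j) \<le> t * (1 / real (Suc n))" .
      qed
      finally show ?thesis by (simp add: mult_ac)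
    qed
    have "(ncdiff y y (t *\<^sub>R h') $ j) z = 0" for j z
    proof (rule LIMSEQ_unique[OF lim1])
      have "(\<lambda>n. t * norm z * (1 / real (Suc n))) \<longlonglongrightarrow> t * norm z * 0"
        by (intro tendsto_mult tendsto_const LIMSEQ_Suc[OF lim_1_over_n])
      then have "(\<lambda>n. t * norm z * (1 / real (Suc (r n)))) \<longlonglongrightarrow> 0"
        using LIMSEQ_subseq_LIMSEQ[OF _ r, of "\<lambda>n. t * norm z * (1 / real (Suc n))"] by (simp add: o_def)
      then show "(\<lambda>n. (ncdiff (xs (r n)) (xs (r n)) (t *\<^sub>R hs (r n)) $ j) z) \<longlonglongrightarrow> 0"
        by (rule Lim_null_comparison[rotated]) (use bound in auto)
    qed
    then have "ncdiff y y (t *\<^sub>R h') = 0" by (simp add: vec_eq_iff blinfun_eq_iff)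
    moreover have "ncdiff y y (t *\<^sub>R h') = t *\<^sub>R ncderiv y y h'"
      by (rule ncderiv_eq[OF reg[OF y y] h'BH t(1)]) (use h'1 t(1) in \<open>simp add: tnorm_scaleR\<close>)
    ultimately have "ncderiv y y h' = ncderiv y y 0" using t(1) ncderiv_0[OF reg[OF y y]] by simp
    moreover have "inj_on (ncderiv y y) (BH J)" using inj has_fderiv_ncderiv \<Omega>k_\<Omega>[OF y] by blast
    ultimately have h'0: "h' = 0" using h'BH BH_zero by (metis inj_onD)
    \<comment> \<open>The coordinate \<open>\<iota> n\<close> in which \<open>h n\<close> is large
      may vary with \<open>n\<close>; summing over all coordinates avoids a further
      subsequence.\<close>
    have "(\<lambda>n. \<Sum>i\<in>UNIV. norm (T (r n) (Inr i) (g 0))) \<longlonglongrightarrow> (\<Sum>i\<in>UNIV. norm ((h' $ i) (g 0)))"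
      using lim by (intro tendsto_sum tendsto_norm) (simp add: h'_def)
    then have "(\<lambda>n. \<Sum>i\<in>(UNIV::'d set). norm (T (r n) (Inr i) (g 0))) \<longlonglongrightarrow> 0" by (simp add: h'0)
    moreover have "1/2 \<le> (\<Sum>i\<in>(UNIV::'d set). norm (T n (Inr i) (g 0)))" for n
    proof -
      obtain s t where st: "u n (v n) = s *\<^sub>R g 0 + t *\<^sub>R J (g 0)" using uv by blast
      have "norm (T n (Inr (\<iota> n)) (g 0)) = norm ((h n $ \<iota> n) (v n))"
        using norm_conj_phase[OF u v g st XJ[of n "Inr (\<iota> n)"]] by (simp add: T_def X_def)
      then have "1/2 \<le> norm (T n (Inr (\<iota> n)) (g 0))" using hv[of n] by simp
      also have "\<dots> \<le> (\<Sum>i\<in>(UNIV::'d set). norm (T n (Inr i) (g 0)))"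
        by (rule member_le_sum) auto
      finally show ?thesis .
    qed
    ultimately have "(1/2 :: real) \<le> 0" by (intro LIMSEQ_le_const) auto
    then show False by simp
  qed
qed

end
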